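(* Let $(V,c)$ be a braided vector space over a field $K$ such that $c$ is a braiding of Hecke type with regular mark $q$. Then $\mathrm{sdeg}(V,c)\le1$.
   Context: $K$ is a field, vector spaces are over $K$, $\otimes=\otimes_K$, and the name of an object also denotes its identity map. A braided vector space $(V,c)$ is a vector space $V$ with a $K$-linear map $c:V\otimes V\to V\otimes V$ such that $(c\otimes V)(V\otimes c)(c\otimes V)=(V\otimes c)(c\otimes V)(V\otimes c)$. The braiding $c$ is of Hecke type with mark $q\in K\setminus\{0\}$ if $(c+\mathrm{Id}_{V\otimes V})(c-q\,\mathrm{Id}_{V\otimes V})=0$. An element $q\in K$ is regular if $(n)_q:=1+q+\cdots+q^{n-1}\ne0$ for all $n\ge2$. A braided algebra $(A,m,u,c)$ is an associative unital algebra with a braided vector space $(A,c)$ such that $c(m\otimes A)=(A\otimes m)(c\otimes A)(A\otimes c)$, $c(A\otimes m)=(m\otimes A)(A\otimes c)(c\otimes A)$, $c(u\otimes A)=A\otimes u$, $c(A\otimes u)=u\otimes A$; braided coalgebras are defined dually. A braided bialgebra is both a braided algebra and a braided coalgebra with $\Delta m=(m\otimes m)(B\otimes c\otimes B)(\Delta\otimes\Delta)$, with $\Delta,\varepsilon$ unital and $\varepsilon$ multiplicative. It is graded if $B=\bigoplus_{n\in\mathbb N}B^n$ with $m,\Delta$ graded, $c(B^a\otimes B^b)\subseteq B^b\otimes B^a$ and $\varepsilon|_{B^n}=0$ for $n>0$; $\Delta_B^{a,b}:B^{a+b}\to B^a\otimes B^b$ are the components of $\Delta$. For a graded braided bialgebra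 $B$, put $E_n(B)=\bigcap_{a,b\ge1,\ a+b=n}\ker(\Delta_B^{a,b})$ for $n\ge2$ and $E(B)=\bigoplus_{n\ge2}E_n(B)$. $S(B)=B/(E(B))$ (quotient by the generated two-sided ideal) is again a graded braided bialgebra via the projection. Put $S^{[0]}(B)=B$, $S^{[n]}(B)=S(S^{[n-1]}(B))$. The strongness degree $\mathrm{sdeg}(B)$ is the least $t\in\mathbb N$ such that the projection $S^{[t]}(B)\to S^{[t+1]}(B)$ is an isomorphism ($\infty$ if none exists). $T(V,c)$ is the tensor algebra with its unique braided bialgebra structure such that the braiding extends $c$ and elements of $V$ are primitive; it is graded by $T^n=V^{\otimes n}$. Put $\mathrm{sdeg}(V,c)=\mathrm{sdeg}(T(V,c))$. *)

theory Defs
  imports Complex_Main "HOL-Library.Poly_Mapping" "HOL-Library.Extended_Nat"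
begin

text \<open>
  Vector spaces are handled through presentations: a record \<open>X\<close> stands for the quotient space
  \<open>carr X / null X\<close>, where \<open>null X \<subseteq> carr X\<close> are subspaces of an ambient vector space given by a type
  and a scalar multiplication. Elements are denoted by representatives, equality in the quotient is
  \<open>x \<approx>[X] y\<close>, and a map between presented spaces is a function on representatives that respects
  this equality. A vector space given by a whole type is the case \<open>carr X = UNIV\<close>, \<open>null X = {0}\<close>.
  Passing to a further quotient enlarges \<open>null X\<close> and keeps the ambient type; this is what makes it
  possible to iterate a quotient construction a variable number of times.
\<close>

record ('k, 'a) vs =
  scl :: "'k \<Rightarrow> 'a \<Rightarrow> 'a"
  carr :: "'a set"
  null :: "'a set"

definition vspace :: "('k::field, 'a::ab_group_add, 'z) vs_scheme \<Rightarrow> bool" where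
  "vspace X \<longleftrightarrow> vector_space (scl X) \<and> module.subspace (scl X) (carr X) \<and>
     module.subspace (scl X) (null X) \<and> null X \<subseteq> carr X"

definition veq :: "('k::field, 'a::ab_group_add, 'z) vs_scheme \<Rightarrow> 'a \<Rightarrow> 'a \<Rightarrow> bool" where
  "veq X x y \<longleftrightarrow> x - y \<in> null X"

abbreviation veq_syntax ("(_ \<approx>[_]/ _)" [51, 0, 51] 50) where
  "x \<approx>[X] y \<equiv> veq X x y"

definition vhom ::
  "('k::field, 'a::ab_group_add, 'z) vs_scheme \<Rightarrow> ('k, 'b::ab_group_add, 'y) vs_scheme \<Rightarrow> ('a \<Rightarrow> 'b) \<Rightarrow> bool"
where
  "vhom X Y f \<longleftrightarrow>
     (\<forall>x\<in>carr X. f x \<in> carr Y) \<and> (\<forall>x\<in>null X. f x \<in> null Y) \<and>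
     (\<forall>x\<in>carr X. \<forall>y\<in>carr X. f (x + y) \<approx>[Y] f x + f y) \<and>
     (\<forall>a. \<forall>x\<in>carr X. f (scl X a x) \<approx>[Y] scl Y a (f x))"

definition viso ::
  "('k::field, 'a::ab_group_add, 'z) vs_scheme \<Rightarrow> ('k, 'b::ab_group_add, 'y) vs_scheme \<Rightarrow> ('a \<Rightarrow> 'b) \<Rightarrow> bool"
where
  "viso X Y f \<longleftrightarrow> vhom X Y f \<and>
     (\<forall>x\<in>carr X. \<forall>x'\<in>carr X. f x \<approx>[Y] f x' \<longrightarrow> x \<approx>[X] x') \<and>
     (\<forall>y\<in>carr Y. \<exists>x\<in>carr X. y \<approx>[Y] f x)"

definition ground :: "('k::field, 'k) vs" where
  "ground = \<lparr>scl = (*), carr = UNIV, null = {0}\<rparr>"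

definition fscale :: "'k::field \<Rightarrow> ('x \<Rightarrow>\<^sub>0 'k) \<Rightarrow> ('x \<Rightarrow>\<^sub>0 'k)" where
  "fscale a p = Poly_Mapping.map ((*) a) p"

abbreviation fspan :: "('x \<Rightarrow>\<^sub>0 'k::field) set \<Rightarrow> ('x \<Rightarrow>\<^sub>0 'k) set" where
  "fspan \<equiv> module.span fscale"

definition lin_ext :: "('x \<Rightarrow> ('y \<Rightarrow>\<^sub>0 'k::field)) \<Rightarrow> ('x \<Rightarrow>\<^sub>0 'k) \<Rightarrow> ('y \<Rightarrow>\<^sub>0 'k)" where
  "lin_ext f p = (\<Sum>x\<in>Poly_Mapping.keys p. fscale (Poly_Mapping.lookup p x) (f x))"

text \<open>
  Tensor powers: \<open>X\<^sup>\<otimes>\<^sup>n\<close> is the free vector space on the words of length \<open>n\<close> with letters in \<open>carr X\<close>,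
  modulo the multilinearity relations; \<open>word [x\<^sub>1, \<dots>, x\<^sub>n]\<close> represents \<open>x\<^sub>1 \<otimes> \<dots> \<otimes> x\<^sub>n\<close>. In particular
  \<open>X \<otimes> X\<close> is \<open>tpow X 2\<close>, and the associativity isomorphisms are identities.
\<close>

abbreviation word :: "'a list \<Rightarrow> ('a list \<Rightarrow>\<^sub>0 'k::field)" where
  "word xs \<equiv> Poly_Mapping.single xs 1"

definition words :: "('k, 'a, 'z) vs_scheme \<Rightarrow> nat \<Rightarrow> 'a list set" where
  "words X n = {xs. set xs \<subseteq> carr X \<and> length xs = n}"

inductive_set trel :: "('k::field, 'a::ab_group_add, 'z) vs_scheme \<Rightarrow> nat \<Rightarrow> ('a list \<Rightarrow>\<^sub>0 'k) set"
  for X n where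
  add: "us @ [x + y] @ ws \<in> words X n \<Longrightarrow> x \<in> carr X \<Longrightarrow> y \<in> carr X \<Longrightarrow>
     word (us @ [x + y] @ ws) - word (us @ [x] @ ws) - word (us @ [y] @ ws) \<in> trel X n"
| scl: "us @ [x] @ ws \<in> words X n \<Longrightarrow>
     word (us @ [scl X a x] @ ws) - fscale a (word (us @ [x] @ ws)) \<in> trel X n"
| null: "us @ [x] @ ws \<in> words X n \<Longrightarrow> x \<in> null X \<Longrightarrow> word (us @ [x] @ ws) \<in> trel X n"

definition tpow :: "('k::field, 'a::ab_group_add, 'z) vs_scheme \<Rightarrow> nat \<Rightarrow> ('k, 'a list \<Rightarrow>\<^sub>0 'k) vs" where
  "tpow X n = \<lparr>scl = fscale, carr = fspan (word ` words X n), null = fspan (trel X n)\<rparr>"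

text \<open>
  \<open>slot i k f\<close> is \<open>X\<^sup>\<otimes>\<^sup>i \<otimes> f \<otimes> X\<^sup>\<otimes>\<^sup>j\<close> for a map \<open>f\<close> defined on \<open>X\<^sup>\<otimes>\<^sup>k\<close>, where \<open>j\<close> is determined by the
  argument: \<open>f\<close> is applied to the \<open>k\<close> tensor factors following the first \<open>i\<close> ones.
\<close>

definition slot ::
  "nat \<Rightarrow> nat \<Rightarrow> (('a list \<Rightarrow>\<^sub>0 'k::field) \<Rightarrow> ('a list \<Rightarrow>\<^sub>0 'k)) \<Rightarrow> ('a list \<Rightarrow>\<^sub>0 'k) \<Rightarrow> ('a list \<Rightarrow>\<^sub>0 'k)"
where
  "slot i k f = lin_ext (\<lambda>xs. lin_ext (\<lambda>ys. word (take i xs @ ys @ drop (i + k) xs))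
                                      (f (word (take k (drop i xs)))))"

definition braided_vector_space ::
  "('k::field, 'a::ab_group_add, 'z) vs_scheme \<Rightarrow> (('a list \<Rightarrow>\<^sub>0 'k) \<Rightarrow> ('a list \<Rightarrow>\<^sub>0 'k)) \<Rightarrow> bool"
where
  "braided_vector_space V c \<longleftrightarrow> vspace V \<and> vhom (tpow V 2) (tpow V 2) c \<and>
     (\<forall>t\<in>carr (tpow V 3).
        slot 0 2 c (slot 1 2 c (slot 0 2 c t)) \<approx>[tpow V 3] slot 1 2 c (slot 0 2 c (slot 1 2 c t)))"

definition hecke_type ::
  "('k::field, 'a::ab_group_add, 'z) vs_scheme \<Rightarrow> (('a list \<Rightarrow>\<^sub>0 'k) \<Rightarrow> ('a list \<Rightarrow>\<^sub>0 'k)) \<Rightarrow> 'k \<Rightarrow> bool"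
where
  "hecke_type V c q \<longleftrightarrow> q \<noteq> 0 \<and>
     (\<forall>t\<in>carr (tpow V 2). c (c t - fscale q t) + (c t - fscale q t) \<approx>[tpow V 2] 0)"

definition qnum :: "'k::field \<Rightarrow> nat \<Rightarrow> 'k" where
  "qnum q n = (\<Sum>i<n. q ^ i)"

definition regular :: "'k::field \<Rightarrow> bool" where
  "regular q \<longleftrightarrow> (\<forall>n\<ge>2. qnum q n \<noteq> 0)"

text \<open>
  The data of a graded braided bialgebra. The multiplication is given as a bilinear operation;
  \<open>mulT\<close>, \<open>comT\<close> and \<open>couT\<close> are multiplication, comultiplication and counit as maps
  \<open>B\<^sup>\<otimes>\<^sup>2 \<rightarrow> B\<^sup>\<otimes>\<^sup>1\<close>, \<open>B\<^sup>\<otimes>\<^sup>1 \<rightarrow> B\<^sup>\<otimes>\<^sup>2\<close> and \<open>B\<^sup>\<otimes>\<^sup>1 \<rightarrow> B\<^sup>\<otimes>\<^sup>0\<close>.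
  The homogeneous component \<open>B\<^sup>n\<close> is the image of \<open>hom B n\<close> in the presented space, so \<open>hom B n\<close> need
  not contain \<open>null B\<close>.
\<close>

record (overloaded) ('k, 'a) gbb = "('k, 'a) vs" +
  mul :: "'a \<Rightarrow> 'a \<Rightarrow> 'a"
  one :: 'a
  com :: "'a \<Rightarrow> ('a list \<Rightarrow>\<^sub>0 'k)"
  cou :: "'a \<Rightarrow> 'k"
  brd :: "('a list \<Rightarrow>\<^sub>0 'k) \<Rightarrow> ('a list \<Rightarrow>\<^sub>0 'k)"
  hom :: "nat \<Rightarrow> 'a set"

definition mulT :: "('k::field, 'a::ab_group_add) gbb \<Rightarrow> ('a list \<Rightarrow>\<^sub>0 'k) \<Rightarrow> ('a list \<Rightarrow>\<^sub>0 'k)" where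
  "mulT B = lin_ext (\<lambda>xs. word [mul B (xs ! 0) (xs ! 1)])"

definition comT :: "('k::field, 'a::ab_group_add) gbb \<Rightarrow> ('a list \<Rightarrow>\<^sub>0 'k) \<Rightarrow> ('a list \<Rightarrow>\<^sub>0 'k)" where
  "comT B = lin_ext (\<lambda>xs. com B (xs ! 0))"

definition couT :: "('k::field, 'a::ab_group_add) gbb \<Rightarrow> ('a list \<Rightarrow>\<^sub>0 'k) \<Rightarrow> ('a list \<Rightarrow>\<^sub>0 'k)" where
  "couT B = lin_ext (\<lambda>xs. Poly_Mapping.single [] (cou B (xs ! 0)))"

definition unital_algebra :: "('k::field, 'a::ab_group_add) gbb \<Rightarrow> bool" where
  "unital_algebra B \<longleftrightarrow> vspace B \<and> one B \<in> carr B \<and>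
     (\<forall>x\<in>carr B. vhom B B (mul B x) \<and> vhom B B (\<lambda>y. mul B y x)) \<and>
     (\<forall>x\<in>carr B. \<forall>y\<in>carr B. \<forall>z\<in>carr B. mul B (mul B x y) z \<approx>[B] mul B x (mul B y z)) \<and>
     (\<forall>x\<in>carr B. mul B (one B) x \<approx>[B] x \<and> mul B x (one B) \<approx>[B] x)"

definition braided_algebra :: "('k::field, 'a::ab_group_add) gbb \<Rightarrow> bool" where
  "braided_algebra B \<longleftrightarrow> unital_algebra B \<and> braided_vector_space B (brd B) \<and>
     (\<forall>t\<in>carr (tpow B 3).
        brd B (slot 0 2 (mulT B) t)
          \<approx>[tpow B 2] slot 1 2 (mulT B) (slot 0 2 (brd B) (slot 1 2 (brd B) t)) \<and>
        brd B (slot 1 2 (mulT B) t)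
          \<approx>[tpow B 2] slot 0 2 (mulT B) (slot 1 2 (brd B) (slot 0 2 (brd B) t))) \<and>
     (\<forall>x\<in>carr B. brd B (word [one B, x]) \<approx>[tpow B 2] word [x, one B] \<and>
                 brd B (word [x, one B]) \<approx>[tpow B 2] word [one B, x])"

definition coalgebra :: "('k::field, 'a::ab_group_add) gbb \<Rightarrow> bool" where
  "coalgebra B \<longleftrightarrow> vspace B \<and> vhom B (tpow B 2) (com B) \<and> vhom B ground (cou B) \<and>
     (\<forall>x\<in>carr B. slot 0 1 (comT B) (com B x) \<approx>[tpow B 3] slot 1 1 (comT B) (com B x) \<and>
        slot 0 1 (couT B) (com B x) \<approx>[tpow B 1] word [x] \<and>
        slot 1 1 (couT B) (com B x) \<approx>[tpow B 1] word [x])"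

definition braided_coalgebra :: "('k::field, 'a::ab_group_add) gbb \<Rightarrow> bool" where
  "braided_coalgebra B \<longleftrightarrow> coalgebra B \<and> braided_vector_space B (brd B) \<and>
     (\<forall>t\<in>carr (tpow B 2).
        slot 0 1 (comT B) (brd B t)
          \<approx>[tpow B 3] slot 1 2 (brd B) (slot 0 2 (brd B) (slot 1 1 (comT B) t)) \<and>
        slot 1 1 (comT B) (brd B t)
          \<approx>[tpow B 3] slot 0 2 (brd B) (slot 1 2 (brd B) (slot 0 1 (comT B) t)) \<and>
        slot 0 1 (couT B) (brd B t) \<approx>[tpow B 1] slot 1 1 (couT B) t \<and>
        slot 1 1 (couT B) (brd B t) \<approx>[tpow B 1] slot 0 1 (couT B) t)"

definition tensor_mul ::
  "('k::field, 'a::ab_group_add) gbb \<Rightarrow> ('a list \<Rightarrow>\<^sub>0 'k) \<Rightarrow> ('a list \<Rightarrow>\<^sub>0 'k)" where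
  \<comment> \<open>\<open>(m \<otimes> m)(B \<otimes> c \<otimes> B)\<close> on \<open>B\<^sup>\<otimes>\<^sup>4\<close>\<close>
  "tensor_mul B t = slot 1 2 (mulT B) (slot 0 2 (mulT B) (slot 1 2 (brd B) t))"

definition braided_bialgebra :: "('k::field, 'a::ab_group_add) gbb \<Rightarrow> bool" where
  "braided_bialgebra B \<longleftrightarrow> braided_algebra B \<and> braided_coalgebra B \<and>
     (\<forall>x\<in>carr B. \<forall>y\<in>carr B.
        com B (mul B x y)
          \<approx>[tpow B 2] tensor_mul B (slot 2 1 (comT B) (slot 0 1 (comT B) (word [x, y]))) \<and>
        cou B (mul B x y) = cou B x * cou B y) \<and>
     com B (one B) \<approx>[tpow B 2] word [one B, one B] \<and> cou B (one B) = 1"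

definition hom2 :: "('k::field, 'a::ab_group_add) gbb \<Rightarrow> nat \<Rightarrow> nat \<Rightarrow> ('a list \<Rightarrow>\<^sub>0 'k) set" where
  \<comment> \<open>\<open>B\<^sup>a \<otimes> B\<^sup>b\<close> as a subspace of \<open>B \<otimes> B\<close>\<close>
  "hom2 B a b = fspan {word [x, y] | x y. x \<in> hom B a \<and> y \<in> hom B b}"

definition com_decomp ::
  "('k::field, 'a::ab_group_add) gbb \<Rightarrow> nat \<Rightarrow> 'a \<Rightarrow> (nat \<Rightarrow> ('a list \<Rightarrow>\<^sub>0 'k)) \<Rightarrow> bool" where
  "com_decomp B n x t \<longleftrightarrow> (\<forall>i\<le>n. t i \<in> hom2 B i (n - i)) \<and> com B x \<approx>[tpow B 2] (\<Sum>i\<le>n. t i)"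

definition graded_braided_bialgebra :: "('k::field, 'a::ab_group_add) gbb \<Rightarrow> bool" where
  "graded_braided_bialgebra B \<longleftrightarrow> braided_bialgebra B \<and>
     (\<forall>n. module.subspace (scl B) (hom B n) \<and> hom B n \<subseteq> carr B) \<and>
     (\<forall>x\<in>carr B. \<exists>f N. (\<forall>n. f n \<in> hom B n) \<and> x \<approx>[B] (\<Sum>n\<le>N. f n)) \<and>
     (\<forall>f N. (\<forall>n. f n \<in> hom B n) \<and> (\<Sum>n\<le>N. f n) \<approx>[B] 0 \<longrightarrow> (\<forall>n\<le>N. f n \<approx>[B] 0)) \<and>
     (\<forall>a b. \<forall>x\<in>hom B a. \<forall>y\<in>hom B b. \<exists>z\<in>hom B (a + b). mul B x y \<approx>[B] z) \<and>
     (\<exists>z\<in>hom B 0. one B \<approx>[B] z) \<and>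
     (\<forall>n. \<forall>x\<in>hom B n. \<exists>t. com_decomp B n x t) \<and>
     (\<forall>a b. \<forall>t\<in>hom2 B a b. \<exists>t'\<in>hom2 B b a. brd B t \<approx>[tpow B 2] t') \<and>
     (\<forall>n>0. \<forall>x\<in>hom B n. cou B x = 0)"

text \<open>
  \<open>com_comp B a b\<close> is \<open>\<Delta>\<^sub>B\<^sup>a\<^sup>,\<^sup>b : B\<^sup>a\<^sup>+\<^sup>b \<rightarrow> B\<^sup>a \<otimes> B\<^sup>b\<close>. The chosen representative is unique modulo
  \<open>null (tpow B 2)\<close>, because \<open>B \<otimes> B\<close> is the direct sum of the \<open>B\<^sup>i \<otimes> B\<^sup>j\<close>.
\<close>

definition com_comp :: "('k::field, 'a::ab_group_add) gbb \<Rightarrow> nat \<Rightarrow> nat \<Rightarrow> 'a \<Rightarrow> ('a list \<Rightarrow>\<^sub>0 'k)" where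
  "com_comp B a b x = (SOME t. \<exists>f. com_decomp B (a + b) x f \<and> t = f a)"

definition E_comp :: "('k::field, 'a::ab_group_add) gbb \<Rightarrow> nat \<Rightarrow> 'a set" where
  "E_comp B n = {x \<in> hom B n. \<forall>a\<ge>1. \<forall>b\<ge>1. a + b = n \<longrightarrow> com_comp B a b x \<approx>[tpow B 2] 0}"

definition E_sum :: "('k::field, 'a::ab_group_add) gbb \<Rightarrow> 'a set" where
  "E_sum B = module.span (scl B) (\<Union>n\<in>{2..}. E_comp B n)"

definition two_sided_ideal :: "('k::field, 'a::ab_group_add) gbb \<Rightarrow> 'a set \<Rightarrow> bool" where
  "two_sided_ideal B I \<longleftrightarrow> module.subspace (scl B) I \<and> null B \<subseteq> I \<and> I \<subseteq> carr B \<and>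
     (\<forall>x\<in>carr B. \<forall>y\<in>I. mul B x y \<in> I \<and> mul B y x \<in> I)"

definition ideal_generated :: "('k::field, 'a::ab_group_add) gbb \<Rightarrow> 'a set \<Rightarrow> 'a set" where
  "ideal_generated B X = \<Inter>{I. two_sided_ideal B I \<and> X \<subseteq> I}"

text \<open>
  The quotient \<open>S(B) = B/(E(B))\<close>: the structure maps and the grading of \<open>S(B)\<close> are induced by those
  of \<open>B\<close>, i.e. given by the same functions on representatives, and the canonical projection
  \<open>B \<rightarrow> S(B)\<close> is the identity on representatives. Since it is a morphism of graded braided
  bialgebras, it is an isomorphism iff it is an isomorphism of vector spaces.
\<close>

definition S_quot :: "('k::field, 'a::ab_group_add) gbb \<Rightarrow> ('k, 'a) gbb" where
  "S_quot B = B\<lparr>null := ideal_generated B (E_sum B)\<rparr>"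

definition sdeg :: "('k::field, 'a::ab_group_add) gbb \<Rightarrow> enat" where
  "sdeg B = Inf {enat t | t. viso ((S_quot ^^ t) B) ((S_quot ^^ Suc t) B) (\<lambda>x. x)}"

text \<open>
  \<open>tensor_bialgebra V c B\<close> states that \<open>B\<close> is \<open>T(V,c)\<close>. Its elements are represented by linear
  combinations of words in \<open>V\<close>, and \<open>v \<in> V\<close> is identified with \<open>word [v]\<close>. Thus an element of
  \<open>V \<otimes> V\<close> becomes an element of \<open>T(V) \<otimes> T(V)\<close> by \<open>embed\<close>, which replaces each letter \<open>v\<close> by the
  letter \<open>word [v]\<close>.
\<close>

definition embed :: "('a list \<Rightarrow>\<^sub>0 'k::field) \<Rightarrow> (('a list \<Rightarrow>\<^sub>0 'k) list \<Rightarrow>\<^sub>0 'k)" where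
  "embed = lin_ext (\<lambda>xs. word (map (\<lambda>v. word [v]) xs))"

definition tensor_bialgebra ::
  "('k::field, 'a::ab_group_add, 'z) vs_scheme \<Rightarrow> (('a list \<Rightarrow>\<^sub>0 'k) \<Rightarrow> ('a list \<Rightarrow>\<^sub>0 'k)) \<Rightarrow>
   ('k, 'a list \<Rightarrow>\<^sub>0 'k) gbb \<Rightarrow> bool"
where
  "tensor_bialgebra V c B \<longleftrightarrow> graded_braided_bialgebra B \<and>
     scl B = fscale \<and>
     carr B = fspan (\<Union>n. word ` words V n) \<and>
     null B = fspan (\<Union>n. trel V n) \<and>
     one B = word [] \<and>
     mul B = (\<lambda>p r. lin_ext (\<lambda>xs. lin_ext (\<lambda>ys. word (xs @ ys)) r) p) \<and>
     (\<forall>n. hom B n = carr (tpow V n)) \<and>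
     (\<forall>t\<in>carr (tpow V 2). brd B (embed t) \<approx>[tpow B 2] embed (c t)) \<and>
     (\<forall>v\<in>carr V. com B (word [v]) \<approx>[tpow B 2] word [word [v], one B] + word [one B, word [v]])"

end

theory Submission
  imports Defs
begin

text \<open>
  Let \<open>I\<close> be the ideal of \<open>T = T(V,c)\<close> generated by \<open>E(T)\<close>, and \<open>S = S(T) = T/I\<close>. The theorem says that
  one step suffices: \<open>E(S) = 0\<close>.

  The braiding becomes a scalar in \<open>S\<close>. On \<open>V \<otimes> V\<close> the component \<open>\<Delta>\<^sup>1\<^sup>,\<^sup>1\<close> of the comultiplication is
  \<open>Id + c\<close>, and the Hecke equation \<open>(c + Id)(c - q Id) = 0\<close> puts every \<open>c t - q t\<close> into its kernel
  \<open>E\<^sub>2(T)\<close>. So \<open>c t\<close> and \<open>q t\<close> have the same image in \<open>S\<close> (\<open>c_hecke\<close>).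

  The component \<open>\<Delta>\<^sup>1\<^sup>,\<^sup>n\<^sup>-\<^sup>1\<close> sends \<open>v\<^sub>1 \<otimes> \<dots> \<otimes> v\<^sub>n\<close> to the sum over \<open>i\<close> of the tensors in which the \<open>i\<close>-th letter
  is moved to the front by \<open>i - 1\<close> applications of \<open>c\<close>. Multiplying the two factors together again and passing to
  \<open>S\<close>, every application of \<open>c\<close> contributes a factor \<open>q\<close>. Hence \<open>m \<Delta>\<^sup>1\<^sup>,\<^sup>n\<^sup>-\<^sup>1\<close> acts on \<open>S\<^sup>n\<close> as
  \<open>1 + q + \<dots> + q\<^sup>n\<^sup>-\<^sup>1 = (n)\<^sub>q\<close> (\<open>mulpart_com_homogeneous\<close>). If \<open>x \<in> S\<^sup>n\<close> with \<open>n \<ge> 2\<close> lies in \<open>E(S)\<close>, then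
  \<open>\<Delta>\<^sup>1\<^sup>,\<^sup>n\<^sup>-\<^sup>1 x = 0\<close>, so \<open>(n)\<^sub>q x = 0\<close>, and regularity of \<open>q\<close> gives \<open>x = 0\<close>.

  The sum over \<open>i\<close> is never written out. The recursion on the first letter (\<open>mulpart_com_letter\<close>) follows from
  multiplicativity of \<open>\<Delta>\<close> and primitivity of that letter. Moreover \<open>m \<Delta>\<^sup>1\<^sup>,\<^sup>n\<^sup>-\<^sup>1\<close> is computed without choosing
  components of \<open>\<Delta> x\<close>: the map \<open>mulpart 1 = m (p\<^sub>1 \<otimes> Id)\<close>, where \<open>p\<^sub>1\<close> is the projection onto degree \<open>1\<close>, is
  defined on all of \<open>T \<otimes> T\<close> and kills the components of bidegree other than \<open>(1, n - 1)\<close>.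

  The structure maps of \<open>T\<close> are linear on representatives only up to elements of the null space. The
  calculations are therefore carried out with \<open>vhom\<close>: such maps compose, they are determined by their values on
  words (\<open>vhom_eq_on_span\<close>, \<open>vhom_eq_flinear\<close>), and a map that is bilinear in this sense on the two letters of a
  word induces one on the tensor square (\<open>vhom_tpow2I\<close>).
\<close>

section \<open>Linear extension\<close>

lemma lookup_fscale [simp]: "Poly_Mapping.lookup (fscale a p) x = a * Poly_Mapping.lookup p x"
  unfolding fscale_def by (simp add: Poly_Mapping.map.rep_eq when_def)

interpretation fin: vector_space "fscale :: 'k::field \<Rightarrow> ('x \<Rightarrow>\<^sub>0 'k) \<Rightarrow> ('x \<Rightarrow>\<^sub>0 'k)"
  by unfold_locales (auto intro!: poly_mapping_eqI simp: lookup_add algebra_simps)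

interpretation fin2: vector_space_pair
  "fscale :: 'k::field \<Rightarrow> ('x \<Rightarrow>\<^sub>0 'k) \<Rightarrow> ('x \<Rightarrow>\<^sub>0 'k)"
  "fscale :: 'k::field \<Rightarrow> ('y \<Rightarrow>\<^sub>0 'k) \<Rightarrow> ('y \<Rightarrow>\<^sub>0 'k)" ..

abbreviation flinear :: "(('x \<Rightarrow>\<^sub>0 'k::field) \<Rightarrow> ('y \<Rightarrow>\<^sub>0 'k)) \<Rightarrow> bool" where
  "flinear \<equiv> Vector_Spaces.linear fscale fscale"

lemma lin_ext_superset:
  assumes "finite S" "Poly_Mapping.keys p \<subseteq> S"
  shows "lin_ext f p = (\<Sum>x\<in>S. fscale (Poly_Mapping.lookup p x) (f x))"
  unfolding lin_ext_def using assms
  by (intro sum.mono_neutral_left) (auto simp: in_keys_iff)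

lemma lin_ext_add: "lin_ext f (p + r) = lin_ext f p + lin_ext f r"
proof -
  let ?S = "Poly_Mapping.keys p \<union> Poly_Mapping.keys r"
  have "Poly_Mapping.keys (p + r) \<subseteq> ?S" by (rule Poly_Mapping.keys_add)
  then show ?thesis
    by (simp add: lin_ext_superset[of ?S] lookup_add fin.scale_left_distrib sum.distrib)
qed

lemma lin_ext_fscale: "lin_ext f (fscale a p) = fscale a (lin_ext f p)"
proof -
  have "Poly_Mapping.keys (fscale a p) \<subseteq> Poly_Mapping.keys p" by (auto simp: in_keys_iff)
  then show ?thesis
    by (simp add: lin_ext_superset[of "Poly_Mapping.keys p"] fin.scale_sum_right)
qed

lemma flinear_lin_ext: "flinear (lin_ext f)"
  by (unfold_locales) (simp_all add: lin_ext_add lin_ext_fscale)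

lemmas lin_ext_diff = fin2.linear_diff[OF flinear_lin_ext]
  and lin_ext_0 [simp] = fin2.linear_0[OF flinear_lin_ext]

lemma lin_ext_single [simp]: "lin_ext f (Poly_Mapping.single x a) = fscale a (f x)"
  by (cases "a = 0") (simp_all add: lin_ext_def)

lemma flinear_eq_lin_ext:
  assumes "flinear F"
  shows "F p = lin_ext (\<lambda>x. F (Poly_Mapping.single x 1)) p"
proof -
  have "p = (\<Sum>x\<in>Poly_Mapping.keys p. fscale (Poly_Mapping.lookup p x) (Poly_Mapping.single x 1))"
    by (rule poly_mapping_eqI)
      (auto simp: lookup_sum lookup_single when_def in_keys_iff if_distrib[of "\<lambda>z. _ * z"]
            cong: if_cong)
  then have "F p = F (\<Sum>x\<in>Poly_Mapping.keys p.
      fscale (Poly_Mapping.lookup p x) (Poly_Mapping.single x 1))"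
    by simp
  then show ?thesis
    by (simp add: lin_ext_def fin2.linear_sum[OF assms] fin2.linear_scale[OF assms])
qed

lemma flinear_lin_ext_lin_ext:
  assumes "flinear F"
  shows "F (lin_ext f p) = lin_ext (\<lambda>x. F (f x)) p"
  by (simp add: lin_ext_def fin2.linear_sum[OF assms] fin2.linear_scale[OF assms])

lemma lin_ext_fun_add: "lin_ext (\<lambda>x. f x + g x) p = lin_ext f p + lin_ext g p"
  by (simp add: lin_ext_def fin.scale_right_distrib sum.distrib)

lemma lin_ext_fun_diff: "lin_ext (\<lambda>x. f x - g x) p = lin_ext f p - lin_ext g p"
  by (simp add: lin_ext_def fin.scale_right_diff_distrib sum_subtractf)

lemma lin_ext_fun_fscale: "lin_ext (\<lambda>x. fscale a (f x)) p = fscale a (lin_ext f p)"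
  by (simp add: lin_ext_def fin.scale_sum_right mult.commute)

lemma flinear_mem:
  assumes "flinear F" "fin.subspace N" "p \<in> fspan S" "\<And>s. s \<in> S \<Longrightarrow> F s \<in> N"
  shows "F p \<in> N"
  using fin.span_minimal[OF _ fin2.linear_subspace_vimage[OF assms(1,2)], of S] assms(3,4) by blast

lemmas lin_ext_mem = flinear_mem[OF flinear_lin_ext]

lemma lin_ext_cong_mod:
  assumes "fin.subspace N" "p \<in> fspan (word ` W)" "\<And>w. w \<in> W \<Longrightarrow> f w - g w \<in> N"
  shows "lin_ext f p - lin_ext g p \<in> N"
proof -
  have "lin_ext (\<lambda>w. f w - g w) p \<in> N"
    by (rule lin_ext_mem[OF assms(1,2)]) (use assms(3) in auto)
  then show ?thesis by (simp add: lin_ext_fun_diff)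
qed

lemma lin_ext_cong_span:
  assumes "p \<in> fspan (word ` W)" "\<And>w. w \<in> W \<Longrightarrow> f w = g w"
  shows "lin_ext f p = lin_ext g p"
  using lin_ext_cong_mod[of "{0}" p W f g] assms by (simp add: fin.subspace_def)

section \<open>Presented vector spaces\<close>

lemma vspaceD:
  assumes "vspace X"
  shows "module (scl X)" "vector_space (scl X)" "module.subspace (scl X) (carr X)"
    "module.subspace (scl X) (null X)" "null X \<subseteq> carr X"
  using assms unfolding vspace_def vector_space_def module_def by auto

lemma vspace_closed:
  assumes "vspace X"
  shows "0 \<in> null X" "0 \<in> carr X"
    "\<And>x y. x \<in> null X \<Longrightarrow> y \<in> null X \<Longrightarrow> x + y \<in> null X"
    "\<And>x y. x \<in> null X \<Longrightarrow> y \<in> null X \<Longrightarrow> x - y \<in> null X"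
    "\<And>x y. x \<in> carr X \<Longrightarrow> y \<in> carr X \<Longrightarrow> x + y \<in> carr X"
    "\<And>x y. x \<in> carr X \<Longrightarrow> y \<in> carr X \<Longrightarrow> x - y \<in> carr X"
    "\<And>a x. x \<in> null X \<Longrightarrow> scl X a x \<in> null X"
    "\<And>a x. x \<in> carr X \<Longrightarrow> scl X a x \<in> carr X"
proof -
  interpret module "scl X" by (rule vspaceD[OF assms])
  note n = vspaceD(4)[OF assms] and c = vspaceD(3)[OF assms]
  show "0 \<in> null X" "0 \<in> carr X"
    "\<And>x y. x \<in> null X \<Longrightarrow> y \<in> null X \<Longrightarrow> x + y \<in> null X"
    "\<And>x y. x \<in> null X \<Longrightarrow> y \<in> null X \<Longrightarrow> x - y \<in> null X"
    "\<And>x y. x \<in> carr X \<Longrightarrow> y \<in> carr X \<Longrightarrow> x + y \<in> carr X"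
    "\<And>x y. x \<in> carr X \<Longrightarrow> y \<in> carr X \<Longrightarrow> x - y \<in> carr X"
    "\<And>a x. x \<in> null X \<Longrightarrow> scl X a x \<in> null X"
    "\<And>a x. x \<in> carr X \<Longrightarrow> scl X a x \<in> carr X"
    by (fact subspace_0[OF n] subspace_0[OF c] subspace_add[OF n] subspace_diff[OF n]
      subspace_add[OF c] subspace_diff[OF c] subspace_scale[OF n] subspace_scale[OF c])+
qed

lemma veq_refl: "vspace X \<Longrightarrow> x \<approx>[X] x"
  by (simp add: veq_def vspace_closed)

lemma veq_sym: "vspace X \<Longrightarrow> x \<approx>[X] y \<Longrightarrow> y \<approx>[X] x"
  using vspace_closed(4)[of X 0 "x - y"] by (simp add: veq_def vspace_closed)

lemma veq_trans: "vspace X \<Longrightarrow> x \<approx>[X] y \<Longrightarrow> y \<approx>[X] z \<Longrightarrow> x \<approx>[X] z"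
  using vspace_closed(3)[of X "x - y" "y - z"] by (simp add: veq_def)

lemma veq_add: "vspace X \<Longrightarrow> x \<approx>[X] y \<Longrightarrow> x' \<approx>[X] y' \<Longrightarrow> x + x' \<approx>[X] y + y'"
  using vspace_closed(3)[of X "x - y" "x' - y'"] by (simp add: veq_def algebra_simps)

lemma veq_scl: "vspace X \<Longrightarrow> x \<approx>[X] y \<Longrightarrow> scl X a x \<approx>[X] scl X a y"
  using vspace_closed(7)[of X "x - y" a] vspaceD(1)[of X]
  by (simp add: veq_def module.scale_right_diff_distrib)

lemma veq_0: "x \<approx>[X] 0 \<longleftrightarrow> x \<in> null X"
  by (simp add: veq_def)

lemma veq_null: "vspace X \<Longrightarrow> x \<approx>[X] y \<Longrightarrow> x \<in> null X \<longleftrightarrow> y \<in> null X"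
  using veq_trans[of X x y 0] veq_trans[of X y x 0] veq_sym[of X] by (auto simp: veq_0)

lemma veq_carr: "vspace X \<Longrightarrow> x \<approx>[X] y \<Longrightarrow> x \<in> carr X \<Longrightarrow> y \<in> carr X"
  using vspace_closed(6)[of X x "x - y"] vspaceD(5)[of X] by (auto simp: veq_def)

lemma vhomD:
  assumes "vhom X Y f"
  shows "\<And>x. x \<in> carr X \<Longrightarrow> f x \<in> carr Y" "\<And>x. x \<in> null X \<Longrightarrow> f x \<in> null Y"
    "\<And>x y. x \<in> carr X \<Longrightarrow> y \<in> carr X \<Longrightarrow> f (x + y) \<approx>[Y] f x + f y"
    "\<And>a x. x \<in> carr X \<Longrightarrow> f (scl X a x) \<approx>[Y] scl Y a (f x)"
  using assms by (auto simp: vhom_def)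

lemma vhom_veq:
  assumes "vspace X" "vspace Y" "vhom X Y f" "x \<approx>[X] y" "y \<in> carr X"
  shows "f x \<approx>[Y] f y"
proof -
  have n: "x - y \<in> null X" using assms by (simp add: veq_def)
  then have "f ((x - y) + y) \<approx>[Y] f (x - y) + f y"
    using assms vspaceD(5)[of X] by (intro vhomD[OF assms(3)]) auto
  moreover have "f (x - y) + f y \<approx>[Y] 0 + f y"
    using vhomD(2)[OF assms(3) n] assms(2) by (intro veq_add veq_refl) (simp_all add: veq_0)
  ultimately show ?thesis using veq_trans[OF assms(2)] by fastforce
qed

lemma vhom_comp:
  assumes "vspace Y" "vspace Z" "vhom X Y f" "vhom Y Z g"
  shows "vhom X Z (\<lambda>x. g (f x))"
  unfolding vhom_def
proof (intro conjI ballI allI)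
  fix x y assume xy: "x \<in> carr X" "y \<in> carr X"
  have "g (f (x + y)) \<approx>[Z] g (f x + f y)"
    using xy assms by (intro vhom_veq[OF assms(1,2,4)]) (auto intro: vhomD vspace_closed)
  also have "\<dots> \<approx>[Z] g (f x) + g (f y)"
    using xy assms by (auto intro: vhomD)
  finally (veq_trans[OF assms(2)]) show "g (f (x + y)) \<approx>[Z] g (f x) + g (f y)" .
next
  fix a x assume x: "x \<in> carr X"
  have "g (f (scl X a x)) \<approx>[Z] g (scl Y a (f x))"
    using x assms by (intro vhom_veq[OF assms(1,2,4)]) (auto intro: vhomD vspace_closed)
  also have "\<dots> \<approx>[Z] scl Z a (g (f x))"
    using x assms by (auto intro: vhomD)
  finally (veq_trans[OF assms(2)]) show "g (f (scl X a x)) \<approx>[Z] scl Z a (g (f x))" .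
qed (use assms in \<open>auto intro: vhomD\<close>)

lemma vhom_add:
  assumes "vspace Y" "vhom X Y f" "vhom X Y g"
  shows "vhom X Y (\<lambda>x. f x + g x)"
  unfolding vhom_def
proof (intro conjI ballI allI)
  fix x y assume xy: "x \<in> carr X" "y \<in> carr X"
  have "f (x + y) + g (x + y) \<approx>[Y] (f x + f y) + (g x + g y)"
    using xy assms by (intro veq_add) (auto intro: vhomD)
  then show "f (x + y) + g (x + y) \<approx>[Y] (f x + g x) + (f y + g y)"
    by (simp add: algebra_simps)
next
  fix a x assume x: "x \<in> carr X"
  have "f (scl X a x) + g (scl X a x) \<approx>[Y] scl Y a (f x) + scl Y a (g x)"
    using x assms by (intro veq_add) (auto intro: vhomD)
  then show "f (scl X a x) + g (scl X a x) \<approx>[Y] scl Y a (f x + g x)"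
    using vspaceD(1)[OF assms(1)] by (simp add: module.scale_right_distrib)
qed (use assms in \<open>auto intro: vhomD vspace_closed\<close>)

lemma vhom_mono:
  assumes "vhom X Y f" "carr X' \<subseteq> carr X" "null X' \<subseteq> null X" "scl X' = scl X"
    "carr Y \<subseteq> carr Y'" "null Y \<subseteq> null Y'" "scl Y' = scl Y"
  shows "vhom X' Y' f"
  using assms(1) assms(2,3,5,6)[THEN subsetD] unfolding vhom_def veq_def assms(4,7) by auto

lemma vhom_eq_on_span:
  assumes "vspace X" "vspace Y" "vhom X Y f" "vhom X Y g"
    "S \<subseteq> carr X" "\<And>s. s \<in> S \<Longrightarrow> f s \<approx>[Y] g s" "x \<in> module.span (scl X) S"
  shows "f x \<approx>[Y] g x"
proof -
  interpret X: module "scl X" by (rule vspaceD[OF assms(1)])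
  let ?E = "{x \<in> carr X. f x \<approx>[Y] g x}"
  have "X.subspace ?E"
  proof (intro X.subspaceI)
    have "f 0 \<in> null Y" "g 0 \<in> null Y"
      using vspace_closed(1)[OF assms(1)] assms(3,4) by (auto intro: vhomD)
    then show "0 \<in> ?E"
      using vspace_closed(2)[OF assms(1)] vspace_closed(4)[OF assms(2)] by (simp add: veq_def)
  next
    fix x y assume "x \<in> ?E" "y \<in> ?E"
    then have e: "x \<in> carr X" "f x \<approx>[Y] g x" "y \<in> carr X" "f y \<approx>[Y] g y" by auto
    have "f (x + y) \<approx>[Y] f x + f y" using e assms(3) by (auto intro: vhomD)
    also have "f x + f y \<approx>[Y] g x + g y" using e assms by (intro veq_add)
    also (veq_trans[OF assms(2)]) have "g x + g y \<approx>[Y] g (x + y)" using e assms by (auto intro: veq_sym vhomD)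
    finally (veq_trans[OF assms(2)]) show "x + y \<in> ?E"
      using e assms vspace_closed by auto
  next
    fix a x assume "x \<in> ?E"
    then have e: "x \<in> carr X" "f x \<approx>[Y] g x" by auto
    have "f (scl X a x) \<approx>[Y] scl Y a (f x)" using e assms(3) by (auto intro: vhomD)
    also have "scl Y a (f x) \<approx>[Y] scl Y a (g x)" using e assms by (intro veq_scl)
    also (veq_trans[OF assms(2)]) have "scl Y a (g x) \<approx>[Y] g (scl X a x)" using e assms by (auto intro: veq_sym vhomD)
    finally (veq_trans[OF assms(2)]) show "scl X a x \<in> ?E"
      using e assms vspace_closed by auto
  qed
  then have "X.span S \<subseteq> ?E" using assms(5,6) by (intro X.span_minimal) auto
  then show ?thesis using assms(7) by auto
qed

lemma vhom_flinear:
  assumes "vspace Y" "scl X = fscale" "scl Y = fscale" "flinear f"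
    "\<And>x. x \<in> carr X \<Longrightarrow> f x \<in> carr Y" "\<And>x. x \<in> null X \<Longrightarrow> f x \<in> null Y"
  shows "vhom X Y f"
  using assms
  by (simp add: vhom_def fin2.linear_add[OF assms(4)] fin2.linear_scale[OF assms(4)] veq_refl)

text \<open>
  This expands \<open>f\<close> linearly over words. Both maps are restricted to the free space on the words, whose null space
  is zero, so that every linear \<open>g\<close> is a homomorphism there.
\<close>
lemma vhom_eq_flinear:
  assumes Y: "vspace Y" "scl Y = fscale" and X: "vspace X" "scl X = fscale"
    and f: "vhom X Y f" and g: "flinear g"
    and W: "word ` W \<subseteq> carr X" "\<And>w. w \<in> W \<Longrightarrow> f (word w) \<approx>[Y] g (word w)"
    and p: "p \<in> fspan (word ` W)"
  shows "f p \<approx>[Y] g p"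
proof -
  let ?F = "\<lparr>scl = fscale, carr = fspan (word ` W), null = {0}\<rparr>"
  have sub: "fin.subspace (carr X)" using vspaceD(3)[OF X(1)] X(2) by simp
  have "vspace ?F"
    by (simp add: vspace_def fin.vector_space_axioms fin.subspace_def fin.span_zero fin.span_add fin.span_scale)
  then show ?thesis
  proof (rule vhom_eq_on_span[OF _ Y(1), where S = "word ` W"])
    show "vhom ?F Y f"
      using fin.span_minimal[OF W(1) sub] vspace_closed(1)[OF X(1)]
      by (intro vhom_mono[OF f]) (simp_all add: X)
    show "vhom ?F Y g"
    proof (rule vhom_flinear[OF Y(1) _ Y(2) g])
      have "g w \<in> carr Y" if "w \<in> word ` W" for w
        using that W by (auto intro!: veq_carr[OF Y(1) _ vhomD(1)[OF f]])
      then show "g x \<in> carr Y" if "x \<in> carr ?F" for x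
        using that vspaceD(3)[OF Y(1)] Y(2) by (auto intro: flinear_mem[OF g])
    qed (simp_all add: fin2.linear_0[OF g] vspace_closed(1)[OF Y(1)])
  qed (use W p in \<open>auto intro: fin.span_base\<close>)
qed

text \<open>
  A sum of homomorphisms, with coefficients taken from a fixed \<open>p\<close>, is a homomorphism. It supplies
  linearity in the outer tensor factors of a product while the inner ones are held fixed.
\<close>
lemma vhom_lin_ext_param:
  assumes "vspace X" "vspace Y" "scl Y = fscale" "p \<in> fspan (word ` W)"
    "\<And>w. w \<in> W \<Longrightarrow> vhom X Y (\<lambda>a. h a w)"
  shows "vhom X Y (\<lambda>a. lin_ext (h a) p)"
proof -
  have sc: "fin.subspace (carr Y)" and sn: "fin.subspace (null Y)"
    using vspaceD[OF assms(2)] assms(3) by auto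
  show ?thesis unfolding vhom_def
  proof (intro conjI ballI allI)
    fix x y assume xy: "x \<in> carr X" "y \<in> carr X"
    have "lin_ext (h (x + y)) p - lin_ext (\<lambda>w. h x w + h y w) p \<in> null Y"
      using vhomD(3)[OF assms(5) xy] by (intro lin_ext_cong_mod[OF sn assms(4)]) (simp add: veq_def)
    then show "lin_ext (h (x + y)) p \<approx>[Y] lin_ext (h x) p + lin_ext (h y) p"
      by (simp add: veq_def lin_ext_fun_add)
  next
    fix a x assume x: "x \<in> carr X"
    have "lin_ext (h (scl X a x)) p - lin_ext (\<lambda>w. fscale a (h x w)) p \<in> null Y"
      using vhomD(4)[OF assms(5) x] assms(3)
      by (intro lin_ext_cong_mod[OF sn assms(4)]) (simp add: veq_def)
    then show "lin_ext (h (scl X a x)) p \<approx>[Y] scl Y a (lin_ext (h x) p)"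
      by (simp add: veq_def lin_ext_fun_fscale assms(3))
  next
    fix x assume "x \<in> carr X"
    then show "lin_ext (h x) p \<in> carr Y"
      by (intro lin_ext_mem[OF sc assms(4)]) (auto dest: vhomD(1)[OF assms(5)])
  next
    fix x assume "x \<in> null X"
    then show "lin_ext (h x) p \<in> null Y"
      by (intro lin_ext_mem[OF sn assms(4)]) (auto dest: vhomD(2)[OF assms(5)])
  qed
qed

section \<open>Tensor powers\<close>

lemma tpow_simps [simp]:
  "scl (tpow X n) = fscale" "carr (tpow X n) = fspan (word ` words X n)"
  "null (tpow X n) = fspan (trel X n)"
  by (simp_all add: tpow_def)

lemma trel_carr:
  assumes "vspace X"
  shows "trel X n \<subseteq> fspan (word ` words X n)"
proof
  have w: "zs \<in> words X n \<Longrightarrow> word zs \<in> fspan (word ` words X n)" for zs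
    by (auto intro: fin.span_base)
  fix t :: "'b list \<Rightarrow>\<^sub>0 'a" assume "t \<in> trel X n"
  then show "t \<in> fspan (word ` words X n)"
  proof cases
    case (add us x y ws)
    then have "us @ [z] @ ws \<in> words X n" if "z \<in> carr X" for z
      using that by (simp add: words_def)
    then show ?thesis using add by (auto intro!: fin.span_diff w)
  next
    case (scl us x ws a)
    then have "us @ [scl X a x] @ ws \<in> words X n"
      using vspace_closed[OF assms] by (simp add: words_def)
    then show ?thesis using scl by (auto intro!: fin.span_diff fin.span_scale w)
  qed (auto intro: w)
qed

lemma vspace_tpow: "vspace X \<Longrightarrow> vspace (tpow X n)"
  using fin.span_minimal[OF trel_carr fin.subspace_span]
  by (simp add: vspace_def fin.vector_space_axioms fin.subspace_span)

lemma words_2: "xs \<in> words X 2 \<longleftrightarrow> (\<exists>x y. xs = [x, y] \<and> x \<in> carr X \<and> y \<in> carr X)"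
  by (auto simp: words_def length_Suc_conv numeral_2_eq_2)

lemma words_2_cases:
  assumes "us @ [x] @ ws \<in> words X 2"
  obtains z where "us = []" "ws = [z]" "x \<in> carr X" "z \<in> carr X"
    | z where "us = [z]" "ws = []" "x \<in> carr X" "z \<in> carr X"
proof (cases us)
  case Nil
  with assms that(1) show ?thesis by (auto simp: words_2)
next
  case (Cons a us')
  with assms that(2)[of a] show ?thesis
    by (cases us') (auto simp: words_2)
qed

lemma words_1: "xs \<in> words X 1 \<longleftrightarrow> (\<exists>x. xs = [x] \<and> x \<in> carr X)"
  by (auto simp: words_def length_Suc_conv)

text \<open>
  The universal property of the tensor square: bilinearity of \<open>g\<close> modulo \<open>null Y\<close> is exactly what makes
  \<open>lin_ext g\<close> respect the three kinds of multilinearity relations.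
\<close>
lemma vhom_tpow2I:
  assumes X: "vspace X" and Y: "vspace Y" "scl Y = fscale"
    and l: "\<And>z. z \<in> carr X \<Longrightarrow> vhom X Y (\<lambda>x. g [x, z])"
    and r: "\<And>z. z \<in> carr X \<Longrightarrow> vhom X Y (\<lambda>x. g [z, x])"
  shows "vhom (tpow X 2) Y (lin_ext g)"
proof (rule vhom_flinear)
  have sc: "fin.subspace (carr Y)" and sn: "fin.subspace (null Y)"
    using vspaceD[OF Y(1)] Y(2) by auto
  fix t :: "'b list \<Rightarrow>\<^sub>0 'a"
  show "lin_ext g t \<in> carr Y" if "t \<in> carr (tpow X 2)"
    by (rule lin_ext_mem[OF sc that[simplified]])
       (auto simp: words_2 dest: vhomD(1)[OF l])
  show "lin_ext g t \<in> null Y" if "t \<in> null (tpow X 2)"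
  proof (rule lin_ext_mem[OF sn that[simplified]])
    fix s assume "s \<in> trel X 2"
    then show "lin_ext g s \<in> null Y"
    proof cases
      case (add us x y ws)
      from add(2) show ?thesis
        by (cases rule: words_2_cases)
          (use add(1,3,4) vhomD(3)[OF l, of _ x y] vhomD(3)[OF r, of _ x y] in
            \<open>simp_all add: lin_ext_diff lin_ext_add veq_def diff_diff_eq\<close>)
    next
      case (scl us x ws a)
      from scl(2) show ?thesis
        by (cases rule: words_2_cases)
          (use scl(1) vhomD(4)[OF l, of _ x a] vhomD(4)[OF r, of _ x a] in
            \<open>simp_all add: lin_ext_diff lin_ext_fscale veq_def Y(2)\<close>)
    next
      case (null us x ws)
      from null(2) show ?thesis
        by (cases rule: words_2_cases)
          (use null(1,3) vhomD(2)[OF l, of _ x] vhomD(2)[OF r, of _ x] in \<open>simp_all\<close>)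
    qed
  qed
qed (use Y in \<open>simp_all add: flinear_lin_ext\<close>)

lemma vhom_letter:
  assumes X: "vspace X" and u: "set us \<subseteq> carr X" and w: "set ws \<subseteq> carr X"
  shows "vhom X (tpow X (length us + length ws + 1)) (\<lambda>x. word (us @ [x] @ ws))"
proof -
  have W: "x \<in> carr X \<Longrightarrow> us @ [x] @ ws \<in> words X (length us + length ws + 1)" for x
    using u w by (simp add: words_def)
  show ?thesis unfolding vhom_def veq_def tpow_simps
  proof (intro conjI ballI allI)
    fix x y assume "x \<in> carr X" "y \<in> carr X"
    then show "word (us @ [x + y] @ ws) - (word (us @ [x] @ ws) + word (us @ [y] @ ws))
        \<in> fspan (trel X (length us + length ws + 1))"
      unfolding diff_diff_eq[symmetric]
      by (intro fin.span_base trel.add W vspace_closed[OF X])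
  next
    fix x assume "x \<in> carr X"
    then show "word (us @ [x] @ ws) \<in> fspan (word ` words X (length us + length ws + 1))"
      by (intro fin.span_base imageI W)
  next
    fix x assume "x \<in> null X"
    moreover from this have "x \<in> carr X" using vspaceD(5)[OF X] by auto
    ultimately show "word (us @ [x] @ ws) \<in> fspan (trel X (length us + length ws + 1))"
      by (intro fin.span_base trel.null W)
  next
    fix a x assume "x \<in> carr X"
    then show "word (us @ [scl X a x] @ ws) - fscale a (word (us @ [x] @ ws))
        \<in> fspan (trel X (length us + length ws + 1))"
      by (intro fin.span_base trel.scl W)
  qed
qed

lemma vhom_pair:
  assumes "vspace X" "z \<in> carr X"
  shows "vhom X (tpow X 2) (\<lambda>x. word [x, z])" "vhom X (tpow X 2) (\<lambda>x. word [z, x])"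
  using vhom_letter[of X "[]" "[z]"] vhom_letter[of X "[z]" "[]"] assms
  by (simp_all add: numeral_2_eq_2)

lemma slot_word:
  "slot i k f (word xs) = lin_ext (\<lambda>ys. word (take i xs @ ys @ drop (i + k) xs))
     (f (word (take k (drop i xs))))"
  by (simp add: slot_def)

lemma flinear_slot: "flinear (slot i k f)"
  unfolding slot_def by (rule flinear_lin_ext)


section \<open>Concatenation of words and homogeneous parts\<close>

lemma flinear_comp: "flinear f \<Longrightarrow> flinear g \<Longrightarrow> flinear (\<lambda>x. g (f x))"
  using Vector_Spaces.linear_compose[of fscale fscale f fscale g] by (simp add: o_def)

lemma flinear_eqI:
  assumes "flinear F" "flinear G" "\<And>x. F (Poly_Mapping.single x 1) = G (Poly_Mapping.single x 1)"
  shows "F p = G p"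
  by (simp add: flinear_eq_lin_ext[OF assms(1), of p] flinear_eq_lin_ext[OF assms(2), of p] assms(3))

text \<open>
  The product of \<open>T(V,c)\<close> on representatives. It also serves as concatenation \<open>T\<^sup>\<otimes>\<^sup>2 \<times> T\<^sup>\<otimes>\<^sup>2 \<rightarrow> T\<^sup>\<otimes>\<^sup>4\<close>,
  with elements of \<open>T\<close> as letters.
\<close>
definition wmul :: "('a list \<Rightarrow>\<^sub>0 'k::field) \<Rightarrow> ('a list \<Rightarrow>\<^sub>0 'k) \<Rightarrow> ('a list \<Rightarrow>\<^sub>0 'k)" where
  "wmul p r = lin_ext (\<lambda>xs. lin_ext (\<lambda>ys. word (xs @ ys)) r) p"

lemma wmul_word [simp]: "wmul (word xs) (word ys) = word (xs @ ys)"
  by (simp add: wmul_def)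

lemma flinear_wmul1: "flinear (\<lambda>p. wmul p r)"
  unfolding wmul_def by (rule flinear_lin_ext)

lemma flinear_wmul2: "flinear (wmul p)"
  by unfold_locales
    (simp_all add: wmul_def lin_ext_add lin_ext_fscale lin_ext_fun_add lin_ext_fun_fscale)

lemmas wmul_scale1 = fin2.linear_scale[OF flinear_wmul1]
  and wmul_scale2 = fin2.linear_scale[OF flinear_wmul2]
  and wmul_0_left [simp] = fin2.linear_0[OF flinear_wmul1]
  and wmul_0_right [simp] = fin2.linear_0[OF flinear_wmul2]

lemma wmul_one_left [simp]: "wmul (word []) p = p"
  by (rule flinear_eqI[OF flinear_wmul2 fin.linear_ident]) simp

lemma wmul_one_right [simp]: "wmul p (word []) = p"
  by (rule flinear_eqI[OF flinear_wmul1 fin.linear_ident]) simp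

lemma wmul_assoc: "wmul (wmul p r) s = wmul p (wmul r s)"
proof (rule flinear_eqI[of "\<lambda>p. wmul (wmul p r) s" "\<lambda>p. wmul p (wmul r s)"])
  fix xs :: "'a list"
  show "wmul (wmul (word xs) r) s = wmul (word xs) (wmul r s)"
  proof (rule flinear_eqI[of "\<lambda>r. wmul (wmul (word xs) r) s" "\<lambda>r. wmul (word xs) (wmul r s)"])
    fix ys :: "'a list"
    show "wmul (wmul (word xs) (word ys)) s = wmul (word xs) (wmul (word ys) s)"
      by (rule flinear_eqI[of "\<lambda>s. wmul (wmul (word xs) (word ys)) s"
            "\<lambda>s. wmul (word xs) (wmul (word ys) s)"])
         (auto intro: flinear_comp flinear_wmul2)
  qed (auto intro: flinear_comp[OF flinear_wmul2 flinear_wmul1]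
         flinear_comp[OF flinear_wmul1 flinear_wmul2])
qed (auto intro: flinear_comp[OF flinear_wmul1 flinear_wmul1] flinear_wmul1)

definition hpart :: "nat \<Rightarrow> ('a list \<Rightarrow>\<^sub>0 'k::field) \<Rightarrow> ('a list \<Rightarrow>\<^sub>0 'k)" where
  "hpart n = lin_ext (\<lambda>xs. if length xs = n then word xs else 0)"

lemma flinear_hpart: "flinear (hpart n)"
  unfolding hpart_def by (rule flinear_lin_ext)

lemma hpart_word [simp]: "hpart n (word xs) = (if length xs = n then word xs else 0)"
  by (simp add: hpart_def)

lemma flinear_eq_on_span:
  assumes "flinear F" "flinear G" "p \<in> fspan S" "\<And>s. s \<in> S \<Longrightarrow> F s = G s"
  shows "F p = G p"
  using fin2.linear_eq_on[OF assms(1,2,3)] assms(4) by blast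

lemma hpart_homogeneous:
  assumes "p \<in> fspan (word ` words X m)"
  shows "hpart n p = (if m = n then p else 0)"
proof -
  have "hpart n p = fscale (if m = n then 1 else 0) p"
    by (rule flinear_eq_on_span[OF flinear_hpart _ assms])
       (auto simp: words_def intro: fin.linear_scale_self)
  then show ?thesis by auto
qed

lemma hpart_letter_wmul: "hpart (Suc n) (wmul (word [v]) p) = wmul (word [v]) (hpart n p)"
  by (rule flinear_eqI[OF flinear_comp[OF flinear_wmul2 flinear_hpart]
        flinear_comp[OF flinear_hpart flinear_wmul2]]) simp

lemma hpart_1_wmul:
  "hpart 1 (wmul p r) = wmul (hpart 0 p) (hpart 1 r) + wmul (hpart 1 p) (hpart 0 r)"
proof (rule flinear_eqI[OF flinear_comp[OF flinear_wmul2 flinear_hpart]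
      fin2.linear_compose_add[OF flinear_comp[OF flinear_hpart flinear_wmul2]
        flinear_comp[OF flinear_hpart flinear_wmul2]]])
  fix ys :: "'a list"
  show "hpart 1 (wmul p (word ys)) =
      wmul (hpart 0 p) (hpart 1 (word ys)) + wmul (hpart 1 p) (hpart 0 (word ys))"
    by (rule flinear_eqI[OF flinear_comp[OF flinear_wmul1 flinear_hpart]
      fin2.linear_compose_add[OF flinear_comp[OF flinear_hpart flinear_wmul1]
        flinear_comp[OF flinear_hpart flinear_wmul1]]]) (auto simp: add_is_1)
qed

lemma hpart_0_wmul: "hpart 0 (wmul p r) = wmul (hpart 0 p) (hpart 0 r)"
proof (rule flinear_eqI[OF flinear_comp[OF flinear_wmul2 flinear_hpart]
      flinear_comp[OF flinear_hpart flinear_wmul2]])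
  fix ys :: "'a list"
  show "hpart 0 (wmul p (word ys)) = wmul (hpart 0 p) (hpart 0 (word ys))"
    by (rule flinear_eqI[OF flinear_comp[OF flinear_wmul1 flinear_hpart]
      flinear_comp[OF flinear_hpart flinear_wmul1]]) auto
qed

text \<open>
  \<open>mulpart k\<close> is \<open>m (p\<^sub>k \<otimes> Id)\<close> on \<open>T \<otimes> T\<close>, where \<open>p\<^sub>k\<close> is the projection of \<open>T\<close> onto degree \<open>k\<close>. On elements
  of total degree \<open>n\<close> it reads off the component of bidegree \<open>(k, n - k)\<close>, multiplied together.
\<close>
definition mulpart ::
  "nat \<Rightarrow> (('a list \<Rightarrow>\<^sub>0 'k::field) list \<Rightarrow>\<^sub>0 'k) \<Rightarrow> ('a list \<Rightarrow>\<^sub>0 'k)" where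
  "mulpart k = lin_ext (\<lambda>xs. wmul (hpart k (xs ! 0)) (xs ! 1))"

lemma flinear_mulpart: "flinear (mulpart k)"
  unfolding mulpart_def by (rule flinear_lin_ext)

lemma mulpart_word [simp]: "mulpart k (word [x, y]) = wmul (hpart k x) y"
  by (simp add: mulpart_def)

section \<open>The tensor algebra\<close>

text \<open>
  The component belongs to some decomposition, but different bidegrees may choose different decompositions.
\<close>
lemma com_comp_decomp:
  assumes "com_decomp B (a + b) x f"
  obtains g where "com_decomp B (a + b) x g" "com_comp B a b x = g a"
  using someI_ex[of "\<lambda>t. \<exists>f. com_decomp B (a + b) x f \<and> t = f a"] assms that
  unfolding com_comp_def by blast

locale tensor_algebra =
  fixes V :: "('k::field, 'v::ab_group_add) vs"
    and c :: "('v list \<Rightarrow>\<^sub>0 'k) \<Rightarrow> ('v list \<Rightarrow>\<^sub>0 'k)"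
    and T :: "('k, 'v list \<Rightarrow>\<^sub>0 'k) gbb"
  assumes bvs: "braided_vector_space V c"
    and tb: "tensor_bialgebra V c T"
begin

lemma vspace_V: "vspace V" and vhom_c: "vhom (tpow V 2) (tpow V 2) c"
  using bvs by (auto simp: braided_vector_space_def)

lemma T_simps [simp]:
  "scl T = fscale" "one T = word []" "mul T = wmul" "hom T n = fspan (word ` words V n)"
  using tb by (auto simp: tensor_bialgebra_def wmul_def fun_eq_iff)

lemma null_T: "null T = fspan (\<Union>n. trel V n)"
  using tb by (simp add: tensor_bialgebra_def)

lemma carr_T: "carr T = fspan (word ` lists (carr V))"
proof -
  have "(\<Union>n. word ` words V n) = (word ` lists (carr V) :: ('v list \<Rightarrow>\<^sub>0 'k) set)"
    by (auto simp: words_def in_lists_conv_set image_iff)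
  then show ?thesis using tb by (simp add: tensor_bialgebra_def)
qed

lemma gbb: "graded_braided_bialgebra T"
  using tb by (simp add: tensor_bialgebra_def)

lemma bba: "braided_bialgebra T"
  using gbb by (simp add: graded_braided_bialgebra_def)

lemma ba: "braided_algebra T" and bc: "braided_coalgebra T"
  using bba by (simp_all add: braided_bialgebra_def)

lemma vspace_T: "vspace T" and vhom_wmul1: "y \<in> carr T \<Longrightarrow> vhom T T (\<lambda>x. wmul x y)"
  and vhom_wmul2: "x \<in> carr T \<Longrightarrow> vhom T T (wmul x)"
  using ba by (simp_all add: braided_algebra_def unital_algebra_def)

lemma vhom_brd: "vhom (tpow T 2) (tpow T 2) (brd T)"
  using ba by (simp add: braided_algebra_def braided_vector_space_def)

lemma brd_one: "x \<in> carr T \<Longrightarrow> brd T (word [word [], x]) \<approx>[tpow T 2] word [x, word []]"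
  using ba by (simp add: braided_algebra_def)

lemma vhom_com: "vhom T (tpow T 2) (com T)" and vhom_cou: "vhom T ground (cou T)"
  and counit: "x \<in> carr T \<Longrightarrow> slot 0 1 (couT T) (com T x) \<approx>[tpow T 1] word [x]"
  using bc by (simp_all add: braided_coalgebra_def coalgebra_def)

lemma com_wmul:
  "x \<in> carr T \<Longrightarrow> y \<in> carr T \<Longrightarrow>
     com T (wmul x y) \<approx>[tpow T 2] tensor_mul T (slot 2 1 (comT T) (slot 0 1 (comT T) (word [x, y])))"
  and com_one: "com T (word []) \<approx>[tpow T 2] word [word [], word []]" and cou_one: "cou T (word []) = 1"
  using bba by (auto simp: braided_bialgebra_def)

lemma com_decomp_ex: "x \<in> fspan (word ` words V n) \<Longrightarrow> \<exists>t. com_decomp T n x t"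
  and brd_graded: "t \<in> hom2 T a b \<Longrightarrow> \<exists>t'\<in>hom2 T b a. brd T t \<approx>[tpow T 2] t'"
  and cou_pos: "n > 0 \<Longrightarrow> x \<in> fspan (word ` words V n) \<Longrightarrow> cou T x = 0"
  using gbb by (auto simp: graded_braided_bialgebra_def)

lemma brd_embed: "t \<in> fspan (word ` words V 2) \<Longrightarrow> brd T (embed t) \<approx>[tpow T 2] embed (c t)"
  and com_letter: "v \<in> carr V \<Longrightarrow>
    com T (word [v]) \<approx>[tpow T 2] word [word [v], word []] + word [word [], word [v]]"
  using tb by (auto simp: tensor_bialgebra_def)

lemmas veq_T_trans [trans] = veq_trans[OF vspace_T]

lemma word_carr_T: "set xs \<subseteq> carr V \<Longrightarrow> word xs \<in> carr T"
  by (auto simp: carr_T in_lists_conv_set intro!: fin.span_base)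

lemma tpow_le_T: "fspan (word ` words V n) \<subseteq> carr T" "fspan (trel V n) \<subseteq> null T"
  unfolding carr_T null_T by (intro fin.span_mono; auto simp: words_def)+

lemma wmul_carr_T: "x \<in> carr T \<Longrightarrow> y \<in> carr T \<Longrightarrow> wmul x y \<in> carr T"
  using vhomD(1)[OF vhom_wmul2] by blast

lemma T_eq_on_words:
  assumes "vspace Y" "vhom T Y f" "vhom T Y g" "x \<in> carr T"
    "\<And>xs. set xs \<subseteq> carr V \<Longrightarrow> f (word xs) \<approx>[Y] g (word xs)"
  shows "f x \<approx>[Y] g x"
  by (rule vhom_eq_on_span[OF vspace_T assms(1-3), of "word ` lists (carr V)"])
     (use assms(4,5) in \<open>auto simp: carr_T in_lists_conv_set subset_eq intro: fin.span_base\<close>)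

text \<open>
  Every multilinearity relation is homogeneous.
\<close>
lemma hpart_null_T:
  assumes "p \<in> null T"
  shows "hpart n p \<in> fspan (trel V n)"
  unfolding hpart_def
proof (rule lin_ext_mem[OF fin.subspace_span assms[unfolded null_T]])
  fix s :: "'v list \<Rightarrow>\<^sub>0 'k" assume "s \<in> (\<Union>m. trel V m)"
  then obtain m where m: "s \<in> trel V m" by auto
  then have "hpart n s = (if m = n then s else 0)"
    using trel_carr[OF vspace_V] by (intro hpart_homogeneous[of _ V]) auto
  then show "lin_ext (\<lambda>xs. if length xs = n then word xs else 0) s \<in> fspan (trel V n)"
    unfolding hpart_def[symmetric] using m by (auto intro: fin.span_base fin.span_zero)
qed

lemma vhom_hpart: "vhom T T (hpart n)"
proof (rule vhom_flinear[OF vspace_T _ _ flinear_hpart])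
  show "hpart n x \<in> carr T" if "x \<in> carr T" for x
    unfolding hpart_def
    by (rule lin_ext_mem[OF vspaceD(3)[OF vspace_T, simplified] that[unfolded carr_T]])
       (use vspace_closed(2)[OF vspace_T] in \<open>auto simp: in_lists_conv_set subset_eq intro!: word_carr_T\<close>)
  show "hpart n x \<in> null T" if "x \<in> null T" for x
    using hpart_null_T[OF that] tpow_le_T(2) by blast
qed simp_all

lemma vhom_wmul_comp1: "vhom T T f \<Longrightarrow> z \<in> carr T \<Longrightarrow> vhom T T (\<lambda>x. wmul (f x) z)"
  by (rule vhom_comp[OF vspace_T vspace_T _ vhom_wmul1])

lemma vhom_wmul_comp2: "vhom T T f \<Longrightarrow> z \<in> carr T \<Longrightarrow> vhom T T (\<lambda>x. wmul z (f x))"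
  by (rule vhom_comp[OF vspace_T vspace_T _ vhom_wmul2])

lemma vhom_hpart_comp: "vhom T T f \<Longrightarrow> vhom T T (\<lambda>x. hpart n (f x))"
  by (rule vhom_comp[OF vspace_T vspace_T _ vhom_hpart])

lemmas vhom_T_intros = vhom_wmul_comp1 vhom_wmul_comp2 vhom_hpart_comp vhom_hpart
  vhom_wmul1 vhom_wmul2 wmul_carr_T vhomD(1)[OF vhom_hpart]

lemma vhom_mulpart: "vhom (tpow T 2) T (mulpart k)"
  unfolding mulpart_def
  by (rule vhom_tpow2I[OF vspace_T vspace_T]) (auto intro!: vhom_T_intros)

section \<open>The comultiplication in bidegree (1, n - 1)\<close>
text \<open>
  This is \<open>m (p\<^sub>1 \<otimes> Id) (m \<otimes> m)\<close> on \<open>a \<otimes> p \<otimes> e\<close> for \<open>p \<in> T \<otimes> T\<close>, as it occurs when \<open>mulpart 1\<close> is applied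
  to a product in the braided tensor square.
\<close>
definition sandwich where
  "sandwich a e = lin_ext (\<lambda>xs. wmul (hpart 1 (wmul a (xs ! 0))) (wmul (xs ! 1) e))"

lemma vhom_sandwich: "a \<in> carr T \<Longrightarrow> e \<in> carr T \<Longrightarrow> vhom (tpow T 2) T (sandwich a e)"
  unfolding sandwich_def
  by (rule vhom_tpow2I[OF vspace_T vspace_T]) (auto intro!: vhom_T_intros)

lemma vhom_sandwich_left:
  assumes "e \<in> carr T" "p \<in> carr (tpow T 2)"
  shows "vhom T T (\<lambda>a. sandwich a e p)"
  unfolding sandwich_def
proof (rule vhom_lin_ext_param[OF vspace_T vspace_T _ assms(2)[simplified]])
  fix w assume "w \<in> words T 2"
  then show "vhom T T (\<lambda>a. wmul (hpart 1 (wmul a (w ! 0))) (wmul (w ! 1) e))"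
    using assms by (auto simp: words_2 intro!: vhom_T_intros)
qed simp

lemma pair_carr: "b \<in> carr T \<Longrightarrow> d \<in> carr T \<Longrightarrow> word [b, d] \<in> carr (tpow T 2)"
  by (auto simp: words_2 intro!: fin.span_base)

lemma brd_carr: "b \<in> carr T \<Longrightarrow> d \<in> carr T \<Longrightarrow> brd T (word [b, d]) \<in> carr (tpow T 2)"
  by (intro vhomD(1)[OF vhom_brd] pair_carr)

lemma mulT_word: "mulT T (word [a, b]) = word [wmul a b]"
  by (simp add: mulT_def)

lemma mulpart_tensor_mul_word:
  assumes "a \<in> carr T" "b \<in> carr T" "d \<in> carr T" "e \<in> carr T"
  shows "mulpart 1 (tensor_mul T (word [a, b, d, e])) = sandwich a e (brd T (word [b, d]))"
proof -
  let ?G = "\<lambda>t. mulpart 1 (slot 1 2 (mulT T) (slot 0 2 (mulT T) t))"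
  have G: "flinear ?G" by (intro flinear_comp[OF _ flinear_mulpart] flinear_comp[OF _ flinear_slot] flinear_slot)
  have "mulpart 1 (tensor_mul T (word [a, b, d, e])) =
      ?G (lin_ext (\<lambda>ys. word (a # ys @ [e])) (brd T (word [b, d])))"
    by (simp add: tensor_mul_def slot_word)
  also have "\<dots> = lin_ext (\<lambda>ys. ?G (word (a # ys @ [e]))) (brd T (word [b, d]))"
    by (rule flinear_lin_ext_lin_ext[OF G])
  also have "\<dots> = sandwich a e (brd T (word [b, d]))"
    unfolding sandwich_def
    by (rule lin_ext_cong_span[OF brd_carr[OF assms(2,3), simplified]])
       (auto simp: words_2 slot_word mulT_word)
  finally show ?thesis .
qed

lemma flinear_tensor_mul: "flinear (tensor_mul T)"
  unfolding tensor_mul_def by (intro flinear_comp[OF _ flinear_slot] flinear_slot)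

lemma flinear_mulpart_tensor_mul:
  "flinear (\<lambda>t. mulpart 1 (tensor_mul T (wmul t s)))" "flinear (\<lambda>s. mulpart 1 (tensor_mul T (wmul t s)))"
  by (intro flinear_comp[OF _ flinear_mulpart] flinear_comp[OF _ flinear_tensor_mul]
      flinear_wmul1 flinear_wmul2)+

text \<open>
  In a product in \<open>T \<otimes> T\<close> the left factor may thus be replaced by a congruent one as long as only \<open>mulpart 1\<close> of
  the result matters. This allows replacing \<open>\<Delta> v\<close> by \<open>v \<otimes> 1 + 1 \<otimes> v\<close>.
\<close>
lemma mulpart_tensor_mul_null:
  assumes "t \<in> null (tpow T 2)" "s \<in> carr (tpow T 2)"
  shows "mulpart 1 (tensor_mul T (wmul t s)) \<in> null T"
proof -
  have word: "mulpart 1 (tensor_mul T (wmul t (word [d, e]))) \<in> null T"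
    if "d \<in> carr T" "e \<in> carr T" for d e
  proof -
    let ?g = "\<lambda>xs. sandwich (xs ! 0) e (brd T (word [xs ! 1, d]))"
    have "vhom (tpow T 2) T (lin_ext ?g)"
    proof (rule vhom_tpow2I[OF vspace_T vspace_T])
      fix z assume "z \<in> carr T"
      then show "vhom T T (\<lambda>x. ?g [x, z])"
        using that by (simp add: vhom_sandwich_left brd_carr del: tpow_simps)
      from \<open>z \<in> carr T\<close> show "vhom T T (\<lambda>x. ?g [z, x])"
        using that vhom_comp[OF vspace_tpow[OF vspace_T] vspace_T
            vhom_comp[OF vspace_tpow[OF vspace_T] vspace_tpow[OF vspace_T]
              vhom_pair(1)[OF vspace_T that(1)] vhom_brd] vhom_sandwich[of z e]]
        by simp
    qed simp
    then have "lin_ext ?g t \<in> null T" using assms(1) by (rule vhomD(2))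
    moreover have "t \<in> fspan (word ` words T 2)"
      using assms(1) vspaceD(5)[OF vspace_tpow[OF vspace_T], of 2] by auto
    then have "lin_ext (\<lambda>xs. mulpart 1 (tensor_mul T (wmul (word xs) (word [d, e])))) t = lin_ext ?g t"
      by (rule lin_ext_cong_span) (use that in \<open>auto simp: words_2 mulpart_tensor_mul_word[simplified]\<close>)
    ultimately show ?thesis
      by (subst flinear_eq_lin_ext[OF flinear_mulpart_tensor_mul(1)]) simp
  qed
  show ?thesis
    unfolding flinear_eq_lin_ext[OF flinear_mulpart_tensor_mul(2), of t s]
    by (rule lin_ext_mem[OF vspaceD(4)[OF vspace_T, simplified] assms(2)[simplified]])
       (auto simp: words_2 word[simplified])
qed

lemma com_carr: "x \<in> carr T \<Longrightarrow> com T x \<in> carr (tpow T 2)"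
  by (rule vhomD(1)[OF vhom_com])

lemma comT_comT:
  assumes "x \<in> carr T"
  shows "slot 2 1 (comT T) (slot 0 1 (comT T) (word [x, y])) = wmul (com T x) (com T y)"
proof -
  have "slot 2 1 (comT T) (slot 0 1 (comT T) (word [x, y])) =
      lin_ext (\<lambda>zs. slot 2 1 (comT T) (word (zs @ [y]))) (com T x)"
    by (simp add: slot_word comT_def flinear_lin_ext_lin_ext[OF flinear_slot])
  also have "\<dots> = wmul (com T x) (com T y)"
    unfolding wmul_def
    by (rule lin_ext_cong_span[OF com_carr[OF assms, simplified]])
       (auto simp: words_2 slot_word comT_def)
  finally show ?thesis .
qed

text \<open>
  \<open>brd_letter v d\<close> is \<open>m (p\<^sub>1 \<otimes> Id) c (v \<otimes> d)\<close>. As \<open>c\<close> exchanges degrees, only the degree one part of \<open>d\<close> counts.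
\<close>
definition brd_letter where
  "brd_letter v d = mulpart 1 (brd T (word [word [v], d]))"

lemma vhom_brd_letter: "v \<in> carr V \<Longrightarrow> vhom T T (brd_letter v)"
  unfolding brd_letter_def
  by (intro vhom_comp[OF vspace_tpow[OF vspace_T] vspace_T _ vhom_mulpart]
      vhom_comp[OF vspace_tpow[OF vspace_T] vspace_tpow[OF vspace_T] _ vhom_brd]
      vhom_pair vspace_T word_carr_T) simp

text \<open>
  The projection \<open>p\<^sub>0\<close> is the counit times \<open>1\<close>, so this is the counit axiom followed by
  \<open>T\<^sup>\<otimes>\<^sup>1 = T\<close>.
\<close>
lemma mulpart_0_com:
  assumes "w \<in> carr T"
  shows "mulpart 0 (com T w) \<approx>[T] w"
proof -
  have null_sub: "fin.subspace (null T)" using vspaceD(4)[OF vspace_T] by simp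
  \<comment> \<open>The grading makes \<open>cou T\<close> vanish on positive degrees.\<close>
  have cou: "hpart 0 d \<approx>[T] fscale (cou T d) (word [])" if "d \<in> carr T" for d
  proof (rule T_eq_on_words[OF vspace_T vhom_hpart _ that])
    show "vhom T T (\<lambda>d. fscale (cou T d) (word []))"
      using vhomD[OF vhom_cou] vspace_closed(1)[OF vspace_T] vspace_closed(8)[OF vspace_T]
        word_carr_T[of "[]"]
      by (auto simp: vhom_def ground_def veq_def fin.scale_left_distrib)
    fix xs assume "set xs \<subseteq> carr V"
    then have "(word xs :: 'v list \<Rightarrow>\<^sub>0 'k) \<in> fspan (word ` words V (length xs))"
      by (auto simp: words_def intro: fin.span_base)
    then show "hpart 0 (word xs) \<approx>[T] fscale (cou T (word xs)) (word [])"
      using cou_pos[of "length xs" "word xs"] cou_one veq_refl[OF vspace_T]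
      by (cases "xs = []") auto
  qed
  have "mulpart 0 (com T w) \<approx>[T] lin_ext (\<lambda>xs. fscale (cou T (xs ! 0)) (xs ! 1)) (com T w)"
    unfolding veq_def mulpart_def
  proof (rule lin_ext_cong_mod[OF null_sub com_carr[OF assms, simplified]])
    fix xs assume "xs \<in> words T 2"
    then obtain d e where de: "xs = [d, e]" "d \<in> carr T" "e \<in> carr T" by (auto simp: words_2)
    then have "wmul (hpart 0 d) e \<approx>[T] wmul (fscale (cou T d) (word [])) e"
      using word_carr_T[of "[]"] vspace_closed(8)[OF vspace_T, of "word []" "cou T d"]
      by (intro vhom_veq[OF vspace_T vspace_T vhom_wmul1] cou) auto
    then show "wmul (hpart 0 (xs ! 0)) (xs ! 1) - fscale (cou T (xs ! 0)) (xs ! 1) \<in> null T"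
      using de by (simp add: wmul_scale1 veq_def)
  qed
  also have "lin_ext (\<lambda>xs. fscale (cou T (xs ! 0)) (xs ! 1)) (com T w) =
      lin_ext hd (slot 0 1 (couT T) (com T w))"
    unfolding slot_def flinear_lin_ext_lin_ext[OF flinear_lin_ext]
    by (rule lin_ext_cong_span[OF com_carr[OF assms, simplified]])
       (auto simp: words_2 couT_def lin_ext_fscale)
  also have "\<dots> \<approx>[T] lin_ext hd (word [w])"
    unfolding veq_def lin_ext_diff[symmetric]
  proof (rule lin_ext_mem[OF null_sub counit[OF assms, unfolded veq_def tpow_simps]])
    fix t assume "t \<in> trel T 1"
    then show "lin_ext hd t \<in> null T"
      using vspace_closed(1)[OF vspace_T]
      by cases (auto simp: words_def lin_ext_diff lin_ext_fscale)
  qed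
  finally show ?thesis by simp
qed

text \<open>
  Multiplicativity gives \<open>\<Delta> (v w) = (v \<otimes> 1 + 1 \<otimes> v) \<Delta> w\<close> in the braided tensor square. The term \<open>v \<otimes> 1\<close> has already
  used up degree one in the first factor, which leaves the degree zero part of \<open>\<Delta> w\<close>, that is \<open>v w\<close>. In the
  term \<open>1 \<otimes> v\<close> the letter \<open>v\<close> has to be braided past the first factor of \<open>\<Delta> w\<close>.
\<close>
lemma mulpart_com_letter:
  assumes v: "v \<in> carr V" and w: "w \<in> carr T"
  shows "mulpart 1 (com T (wmul (word [v]) w)) \<approx>[T]
    wmul (word [v]) w + lin_ext (\<lambda>xs. wmul (brd_letter v (xs ! 0)) (xs ! 1)) (com T w)"
proof -
  let ?F = "\<lambda>t s. mulpart 1 (tensor_mul T (wmul t s))"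
  have null_sub: "fin.subspace (null T)" using vspaceD(4)[OF vspace_T] by simp
  have vT: "word [v] \<in> carr T" and oT: "word [] \<in> carr T" using v by (auto intro: word_carr_T)
  note cw = com_carr[OF w]
  have "mulpart 1 (com T (wmul (word [v]) w)) \<approx>[T] ?F (com T (word [v])) (com T w)"
  proof (rule vhom_veq[OF vspace_tpow[OF vspace_T] vspace_T vhom_mulpart])
    show "com T (wmul (word [v]) w) \<approx>[tpow T 2] tensor_mul T (wmul (com T (word [v])) (com T w))"
      using com_wmul[OF vT w] by (simp only: comT_comT[OF vT])
    then show "tensor_mul T (wmul (com T (word [v])) (com T w)) \<in> carr (tpow T 2)"
      using com_carr[OF wmul_carr_T[OF vT w]] by (rule veq_carr[OF vspace_tpow[OF vspace_T]])
  qed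
  also have "?F (com T (word [v])) (com T w) \<approx>[T]
      ?F (word [word [v], word []] + word [word [], word [v]]) (com T w)"
    unfolding veq_def fin2.linear_diff[OF flinear_mulpart_tensor_mul(1), symmetric]
    using com_letter[OF v] cw unfolding veq_def by (rule mulpart_tensor_mul_null)
  also have "\<dots> = ?F (word [word [v], word []]) (com T w) + ?F (word [word [], word [v]]) (com T w)"
    by (rule fin2.linear_add[OF flinear_mulpart_tensor_mul(1)])
  also have "\<dots> \<approx>[T] wmul (word [v]) w + lin_ext (\<lambda>xs. wmul (brd_letter v (xs ! 0)) (xs ! 1)) (com T w)"
  proof (rule veq_add[OF vspace_T])
    have "?F (word [word [v], word []]) (com T w) \<approx>[T]
        lin_ext (\<lambda>xs. wmul (word [v]) (wmul (hpart 0 (xs ! 0)) (xs ! 1))) (com T w)"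
      unfolding veq_def flinear_eq_lin_ext[OF flinear_mulpart_tensor_mul(2), of _ "com T w"]
    proof (rule lin_ext_cong_mod[OF null_sub cw[simplified]])
      fix xs assume "xs \<in> words T 2"
      then obtain d e where de: "xs = [d, e]" "d \<in> carr T" "e \<in> carr T" by (auto simp: words_2)
      have "sandwich (word [v]) e (brd T (word [word [], d])) \<approx>[T] sandwich (word [v]) e (word [d, word []])"
        using de vT oT
        by (intro vhom_veq[OF vspace_tpow[OF vspace_T] vspace_T vhom_sandwich] brd_one pair_carr)
      then show "?F (word [word [v], word []]) (word xs)
          - wmul (word [v]) (wmul (hpart 0 (xs ! 0)) (xs ! 1)) \<in> null T"
        using de mulpart_tensor_mul_word[OF vT oT, of d e] hpart_letter_wmul[of 0 v d]
        by (simp add: veq_def sandwich_def wmul_assoc)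
    qed
    also have "lin_ext (\<lambda>xs. wmul (word [v]) (wmul (hpart 0 (xs ! 0)) (xs ! 1))) (com T w)
        = wmul (word [v]) (mulpart 0 (com T w))"
      by (simp add: mulpart_def flinear_lin_ext_lin_ext[OF flinear_wmul2])
    also have "\<dots> \<approx>[T] wmul (word [v]) w"
      by (rule vhom_veq[OF vspace_T vspace_T vhom_wmul2[OF vT] mulpart_0_com[OF w] w])
    finally show "?F (word [word [v], word []]) (com T w) \<approx>[T] wmul (word [v]) w" .
    have "?F (word [word [], word [v]]) (com T w) =
        lin_ext (\<lambda>xs. wmul (brd_letter v (xs ! 0)) (xs ! 1)) (com T w)"
      unfolding flinear_eq_lin_ext[OF flinear_mulpart_tensor_mul(2), of _ "com T w"]
    proof (rule lin_ext_cong_span[OF cw[simplified]])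
      fix xs assume "xs \<in> words T 2"
      then obtain d e where de: "xs = [d, e]" "d \<in> carr T" "e \<in> carr T" by (auto simp: words_2)
      have "sandwich (word []) e p = wmul (mulpart 1 p) e" for p
        by (simp add: sandwich_def mulpart_def wmul_assoc
            flinear_lin_ext_lin_ext[OF flinear_wmul1])
      then show "?F (word [word [], word [v]]) (word xs) = wmul (brd_letter v (xs ! 0)) (xs ! 1)"
        using de mulpart_tensor_mul_word[OF oT vT, of d e] by (simp add: brd_letter_def)
    qed
    then show "?F (word [word [], word [v]]) (com T w) \<approx>[T]
        lin_ext (\<lambda>xs. wmul (brd_letter v (xs ! 0)) (xs ! 1)) (com T w)"
      by (simp add: veq_refl[OF vspace_T])
  qed
  finally show ?thesis .
qed

lemma mulpart_hom2:
  assumes "t \<in> hom2 T i j" "i \<noteq> k"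
  shows "mulpart k t = 0"
proof -
  have "mulpart k t \<in> {0}"
    by (rule flinear_mem[OF flinear_mulpart _ assms(1)[unfolded hom2_def]])
       (use assms(2) in \<open>auto simp: fin.subspace_def hpart_homogeneous[of _ V]\<close>)
  then show ?thesis by simp
qed

text \<open>
  In degree one \<open>brd_letter v\<close> is the braiding of \<open>V\<close>, because the braiding of \<open>T\<close> extends it. In the other degrees
  it vanishes, because \<open>c\<close> maps \<open>T\<^sup>1 \<otimes> T\<^sup>n\<close> to \<open>T\<^sup>n \<otimes> T\<^sup>1\<close>.
\<close>
lemma brd_letter_word:
  assumes v: "v \<in> carr V" and xs: "set xs \<subseteq> carr V"
  shows "brd_letter v (word xs) \<approx>[T] (if length xs = 1 then c (word (v # xs)) else 0)"
proof (cases "length xs = 1")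
  case True
  then obtain u where u: "xs = [u]" "u \<in> carr V" using xs by (auto simp: length_Suc_conv)
  have w: "word [v, u] \<in> carr (tpow V 2)"
    using u v by (auto simp: words_2 intro!: fin.span_base)
  have cc: "c (word [v, u]) \<in> fspan (word ` words V 2)"
    using vhomD(1)[OF vhom_c w] by simp
  have "brd T (embed (word [v, u])) \<approx>[tpow T 2] embed (c (word [v, u]))"
    using w by (intro brd_embed) simp
  then have "brd T (word [word [v], word [u]]) \<approx>[tpow T 2] embed (c (word [v, u]))"
    by (simp add: embed_def)
  moreover have "embed (c (word [v, u])) \<in> carr (tpow T 2)"
    unfolding embed_def tpow_simps
    by (rule lin_ext_mem[OF fin.subspace_span cc])
       (auto simp: words_2 intro!: pair_carr[simplified] word_carr_T)
  ultimately have "brd_letter v (word [u]) \<approx>[T] mulpart 1 (embed (c (word [v, u])))"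
    unfolding brd_letter_def
    by (rule vhom_veq[OF vspace_tpow[OF vspace_T] vspace_T vhom_mulpart])
  also have "mulpart 1 (embed (c (word [v, u]))) = c (word [v, u])"
    unfolding embed_def flinear_lin_ext_lin_ext[OF flinear_mulpart]
    by (subst (2) flinear_eq_lin_ext[OF fin.linear_ident], rule lin_ext_cong_span[OF cc])
       (auto simp: words_2)
  finally show ?thesis using u by simp
next
  case False
  have "word [word [v], word xs] \<in> hom2 T 1 (length xs)"
  proof -
    have "(word [v] :: 'v list \<Rightarrow>\<^sub>0 'k) \<in> hom T 1" "(word xs :: 'v list \<Rightarrow>\<^sub>0 'k) \<in> hom T (length xs)"
      using v xs by (auto simp: words_def intro!: fin.span_base)
    then show ?thesis unfolding hom2_def by (blast intro: fin.span_base)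
  qed
  then obtain t where t: "t \<in> hom2 T (length xs) 1" "brd T (word [word [v], word xs]) \<approx>[tpow T 2] t"
    using brd_graded by blast
  have "mulpart 1 t = 0" using mulpart_hom2[OF t(1)] False by simp
  moreover have "t \<in> carr (tpow T 2)"
    using t(1) unfolding hom2_def tpow_simps
    by (rule set_mp[OF fin.span_mono, rotated])
       (use tpow_le_T(1) in \<open>force simp: words_2\<close>)
  then have "brd_letter v (word xs) \<approx>[T] mulpart 1 t"
    unfolding brd_letter_def
    by (rule vhom_veq[OF vspace_tpow[OF vspace_T] vspace_T vhom_mulpart t(2)])
  ultimately show ?thesis using False by simp
qed

lemma mulpart_decomp:
  assumes "\<forall>i\<le>n. f i \<in> hom2 T i (n - i)" "k \<le> n"
  shows "mulpart k (\<Sum>i\<le>n. f i) = mulpart k (f k)"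
proof -
  have "mulpart k (\<Sum>i\<le>n. f i) = (\<Sum>i\<le>n. if i = k then mulpart k (f k) else 0)"
    unfolding fin2.linear_sum[OF flinear_mulpart]
    by (rule sum.cong) (use assms mulpart_hom2 in auto)
  then show ?thesis using assms(2) by simp
qed

lemma vhom_com_mulpart: "vhom T T (\<lambda>x. mulpart k (com T x))"
  by (rule vhom_comp[OF vspace_tpow[OF vspace_T] vspace_T vhom_com vhom_mulpart])

section \<open>Primitive elements of degree two\<close>
lemma vhom_letter_action:
  "v \<in> carr V \<Longrightarrow> vhom (tpow T 2) T (lin_ext (\<lambda>xs. wmul (brd_letter v (xs ! 0)) (xs ! 1)))"
  by (rule vhom_tpow2I[OF vspace_T vspace_T])
     (auto intro!: vhom_wmul_comp1 vhom_wmul2 vhom_brd_letter vhomD(1)[OF vhom_brd_letter])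

text \<open>
  This is \<open>\<Delta>\<^sup>1\<^sup>,\<^sup>1 = Id + c\<close>, under the identification of \<open>T\<^sup>1 \<otimes> T\<^sup>1\<close> with \<open>T\<^sup>2\<close> by multiplication.
\<close>
lemma mulpart_com_2:
  assumes "x \<in> carr (tpow V 2)"
  shows "mulpart 1 (com T x) \<approx>[T] x + c x"
proof (rule vhom_eq_on_span[OF vspace_tpow[OF vspace_V] vspace_T, where S = "word ` words V 2" and
      f = "\<lambda>x. mulpart 1 (com T x)" and g = "\<lambda>x. x + c x"])
  show "vhom (tpow V 2) T (\<lambda>x. mulpart 1 (com T x))"
    by (rule vhom_mono[OF vhom_com_mulpart]) (simp_all add: tpow_le_T)
  have "vhom (tpow V 2) T (\<lambda>x. x)"
    using tpow_le_T by (intro vhom_flinear vspace_T) (auto simp: fin.linear_ident)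
  moreover have "vhom (tpow V 2) T c"
    by (rule vhom_mono[OF vhom_c]) (simp_all add: tpow_le_T)
  ultimately show "vhom (tpow V 2) T (\<lambda>x. x + c x)" by (rule vhom_add[OF vspace_T])
next
  fix s :: "'v list \<Rightarrow>\<^sub>0 'k" assume "s \<in> word ` words V 2"
  then obtain v u where s: "s = word [v, u]" and vu: "v \<in> carr V" "u \<in> carr V"
    by (auto simp: words_2)
  let ?L = "lin_ext (\<lambda>xs. wmul (brd_letter v (xs ! 0)) (xs ! 1))"
  have uT: "word [u] \<in> carr T" and oT: "word [] \<in> carr T" using vu by (auto intro: word_carr_T)
  have "?L (com T (word [u])) \<approx>[T] ?L (word [word [u], word []] + word [word [], word [u]])"
    by (rule vhom_veq[OF vspace_tpow[OF vspace_T] vspace_T vhom_letter_action[OF vu(1)] com_letter[OF vu(2)]])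
       (intro vspace_closed(5)[OF vspace_tpow[OF vspace_T]] pair_carr uT oT)
  also have "\<dots> = brd_letter v (word [u]) + wmul (brd_letter v (word [])) (word [u])"
    by (simp add: lin_ext_add)
  also have "\<dots> \<approx>[T] c (word [v, u]) + wmul 0 (word [u])"
    using brd_letter_word[OF vu(1), of "[u]"] brd_letter_word[OF vu(1), of "[]"] vu(2)
    by (intro veq_add[OF vspace_T] vhom_veq[OF vspace_T vspace_T vhom_wmul1[OF uT]])
       (simp_all add: vspace_closed(2)[OF vspace_T])
  finally have "?L (com T (word [u])) \<approx>[T] c (word [v, u])" by simp
  then have "word [v, u] + ?L (com T (word [u])) \<approx>[T] word [v, u] + c (word [v, u])"
    by (intro veq_add[OF vspace_T] veq_refl[OF vspace_T])
  then show "mulpart 1 (com T s) \<approx>[T] s + c s"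
    using veq_trans[OF vspace_T mulpart_com_letter[OF vu(1) uT]] s by simp
qed (use assms in \<open>auto intro: fin.span_base\<close>)

lemma vhom_embed: "vhom (tpow V 2) (tpow T 2) embed"
proof -
  have l: "vhom V T (\<lambda>x. word [x])"
    by (rule vhom_mono[OF vhom_letter[OF vspace_V, of "[]" "[]", simplified]])
      (use tpow_le_T[of 1] in simp_all)
  show ?thesis unfolding embed_def
    by (rule vhom_tpow2I[OF vspace_V vspace_tpow[OF vspace_T]])
       (auto intro!: vhom_comp[OF vspace_T vspace_tpow[OF vspace_T] l] vhom_pair[OF vspace_T] word_carr_T)
qed

text \<open>
  Multiplication \<open>T\<^sup>1 \<otimes> T\<^sup>1 \<rightarrow> T\<^sup>2\<close> is injective, with left inverse \<open>embed\<close>. Hence \<open>\<Delta>\<^sup>1\<^sup>,\<^sup>1 x\<close> vanishes as soon as its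
  product does.
\<close>
lemma embed_mulpart:
  assumes "t \<in> hom2 T 1 1"
  shows "t \<approx>[tpow T 2] embed (mulpart 1 t)"
  unfolding veq_def
proof (rule flinear_mem[OF _ _ assms[unfolded hom2_def]])
  show "flinear (\<lambda>t. t - embed (mulpart 1 t))"
    unfolding embed_def
    by (intro fin2.linear_compose_sub fin.linear_ident flinear_comp[OF flinear_mulpart flinear_lin_ext])
  fix s :: "('v list \<Rightarrow>\<^sub>0 'k) list \<Rightarrow>\<^sub>0 'k"
  assume "s \<in> {word [x, y] | x y. x \<in> hom T 1 \<and> y \<in> hom T 1}"
  then obtain x y where s: "s = word [x, y]" and xy: "x \<in> fspan (word ` words V 1)" "y \<in> fspan (word ` words V 1)"
    by auto
  have yT: "y \<in> carr T" using xy tpow_le_T by blast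
  have w1: "word ` words V 1 \<subseteq> carr T" by (auto simp: words_def intro!: word_carr_T)
  have "word [x, y] \<approx>[tpow T 2] embed (wmul (hpart 1 x) y)"
  proof (rule vhom_eq_flinear[OF vspace_tpow[OF vspace_T] _ vspace_T _ vhom_pair(1)[OF vspace_T yT] _ w1 _ xy(1)])
    show "flinear (\<lambda>x. embed (wmul (hpart 1 x) y))"
      unfolding embed_def
      by (intro flinear_comp[OF _ flinear_lin_ext] flinear_comp[OF flinear_hpart flinear_wmul1])
    fix vs assume vs: "vs \<in> words V 1"
    show "word [word vs, y] \<approx>[tpow T 2] embed (wmul (hpart 1 (word vs)) y)"
    proof (rule vhom_eq_flinear[OF vspace_tpow[OF vspace_T] _ vspace_T _ vhom_pair(2)[OF vspace_T] _ w1 _ xy(2)])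
      show "word vs \<in> carr T" using vs w1 by auto
      show "flinear (\<lambda>y. embed (wmul (hpart 1 (word vs)) y))"
        unfolding embed_def by (intro flinear_comp[OF _ flinear_lin_ext] flinear_wmul2)
      fix us assume "us \<in> words V 1"
      then show "word [word vs, word us] \<approx>[tpow T 2] embed (wmul (hpart 1 (word vs)) (word us))"
        using vs veq_refl[OF vspace_tpow[OF vspace_T]] unfolding words_1 by (auto simp: embed_def)
    qed simp_all
  qed simp_all
  then show "s - embed (mulpart 1 s) \<in> null (tpow T 2)" by (simp add: s veq_def)
qed simp

text \<open>
  As multiplication is injective on \<open>T\<^sup>1 \<otimes> T\<^sup>1\<close>, the product \<open>x + c x\<close> of the two factors of \<open>\<Delta>\<^sup>1\<^sup>,\<^sup>1 x\<close> detects
  whether \<open>\<Delta>\<^sup>1\<^sup>,\<^sup>1 x\<close> vanishes.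
\<close>
lemma E_comp_2I:
  assumes x: "x \<in> carr (tpow V 2)" and cx: "c x + x \<approx>[tpow V 2] 0"
  shows "x \<in> E_comp T 2"
proof -
  have xT: "x \<in> carr T" using x tpow_le_T by auto
  obtain f0 where "com_decomp T (1 + 1) x f0"
    using com_decomp_ex[of x 2] x by (auto simp: numeral_2_eq_2)
  then obtain f where f: "com_decomp T (1 + 1) x f" and eq: "com_comp T 1 1 x = f 1"
    by (rule com_comp_decomp)
  then have f1: "f 1 \<in> hom2 T 1 1" and fs: "\<forall>i\<le>1 + 1. f i \<in> hom2 T i (1 + 1 - i)"
    and cs: "com T x \<approx>[tpow T 2] (\<Sum>i\<le>1 + 1. f i)"
    by (auto simp: com_decomp_def)
  have "mulpart 1 (com T x) \<approx>[T] mulpart 1 (\<Sum>i\<le>1 + 1. f i)"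
    by (rule vhom_veq[OF vspace_tpow[OF vspace_T] vspace_T vhom_mulpart cs
          veq_carr[OF vspace_tpow[OF vspace_T] cs com_carr[OF xT]]])
  then have "mulpart 1 (com T x) \<approx>[T] mulpart 1 (f 1)"
    using mulpart_decomp[OF fs, of 1] by simp
  moreover have "mulpart 1 (com T x) \<in> null T"
    using mulpart_com_2[OF x] cx tpow_le_T(2)[of 2] veq_null[OF vspace_T]
    by (auto simp: veq_0 add.commute)
  ultimately have n: "mulpart 1 (f 1) \<in> null T"
    using veq_null[OF vspace_T] by blast
  have "mulpart 1 (f 1) \<in> fspan (word ` words V 2)"
  proof (rule flinear_mem[OF flinear_mulpart fin.subspace_span f1[unfolded hom2_def]])
    fix s :: "('v list \<Rightarrow>\<^sub>0 'k) list \<Rightarrow>\<^sub>0 'k"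
    assume "s \<in> {word [x, y] | x y. x \<in> hom T 1 \<and> y \<in> hom T 1}"
    then obtain x y where s: "s = word [x, y]"
      and xy: "x \<in> fspan (word ` words V 1)" "y \<in> fspan (word ` words V 1)" by auto
    have "wmul x y \<in> fspan (word ` words V 2)"
    proof (rule flinear_mem[OF flinear_wmul1 fin.subspace_span xy(1)])
      fix s :: "'v list \<Rightarrow>\<^sub>0 'k" assume "s \<in> word ` words V 1"
      then show "wmul s y \<in> fspan (word ` words V 2)"
        by (intro flinear_mem[OF flinear_wmul2 fin.subspace_span xy(2)])
           (auto simp: words_def intro!: fin.span_base)
    qed
    then show "mulpart 1 s \<in> fspan (word ` words V 2)"
      by (simp add: s hpart_homogeneous[OF xy(1)])
  qed
  then have "mulpart 1 (f 1) \<in> null (tpow V 2)"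
    using hpart_null_T[OF n, of 2] hpart_homogeneous[of "mulpart 1 (f 1)" V 2 2] by simp
  then have "embed (mulpart 1 (f 1)) \<in> null (tpow T 2)"
    by (rule vhomD(2)[OF vhom_embed])
  then have "f 1 \<approx>[tpow T 2] 0"
    using embed_mulpart[OF f1] veq_null[OF vspace_tpow[OF vspace_T]] by (auto simp: veq_0)
  then have "com_comp T a b x \<approx>[tpow T 2] 0" if "a \<ge> 1" "b \<ge> 1" "a + b = 2" for a b
  proof -
    from that have "a = 1" "b = 1" by auto
    with eq \<open>f 1 \<approx>[tpow T 2] 0\<close> show ?thesis by simp
  qed
  with x show ?thesis by (simp add: E_comp_def)
qed

section \<open>The quotient by the primitive elements of higher degree\<close>

abbreviation I where "I \<equiv> ideal_generated T (E_sum T)"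
abbreviation S where "S \<equiv> S_quot T"

lemma S_simps [simp]:
  "scl S = fscale" "carr S = carr T" "null S = I" "mul S = wmul" "com S = com T"
  "hom S n = fspan (word ` words V n)" "hom2 S = hom2 T"
  by (simp_all add: S_quot_def hom2_def fun_eq_iff)

lemma subspace_T: "fin.subspace (carr T)" "fin.subspace (null T)"
  using vspaceD(3,4)[OF vspace_T] by simp_all

lemma two_sided_carr: "two_sided_ideal T (carr T)"
  using vspaceD[OF vspace_T] by (simp add: two_sided_ideal_def wmul_carr_T)

lemma E_sum_subset:
  assumes "fin.subspace J" "\<And>n. n \<ge> 2 \<Longrightarrow> fspan (word ` words V n) \<subseteq> J"
  shows "E_sum T \<subseteq> J"
  unfolding E_sum_def T_simps
  by (rule fin.span_minimal[OF _ assms(1)]) (use assms(2) in \<open>auto simp: E_comp_def\<close>)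

lemma I_subset: "two_sided_ideal T J \<Longrightarrow> E_sum T \<subseteq> J \<Longrightarrow> I \<subseteq> J"
  by (auto simp: ideal_generated_def)

lemma I_carr: "I \<subseteq> carr T"
  by (intro I_subset two_sided_carr E_sum_subset subspace_T tpow_le_T)

lemma null_I: "null T \<subseteq> I" and E_sum_I: "E_sum T \<subseteq> I"
  by (auto simp: ideal_generated_def two_sided_ideal_def)

lemma subspace_I: "fin.subspace I"
  unfolding ideal_generated_def
  by (rule fin.subspace_Inter) (auto simp: two_sided_ideal_def)

lemma I_wmul: "x \<in> carr T \<Longrightarrow> y \<in> I \<Longrightarrow> wmul x y \<in> I" "x \<in> carr T \<Longrightarrow> y \<in> I \<Longrightarrow> wmul y x \<in> I"
  by (auto simp: ideal_generated_def two_sided_ideal_def)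

lemma vspace_S: "vspace S"
  using I_carr subspace_I subspace_T by (simp add: vspace_def fin.vector_space_axioms)

lemmas veq_S_trans [trans] = veq_trans[OF vspace_S]

lemma veq_S: "x \<approx>[T] y \<Longrightarrow> x \<approx>[S] y"
  using null_I by (auto simp: veq_def)

lemma vhom_S: "vhom X T f \<Longrightarrow> vhom X S f"
  by (rule vhom_mono[of X T f]) (use null_I in simp_all)

text \<open>
  An ideal generated in degrees at least two is zero in degrees zero and one. The set of elements with vanishing parts
  in both degrees is an ideal, whereas degree one alone would not give one.
\<close>
lemma hpart_1_I:
  assumes "x \<in> I"
  shows "hpart 1 x \<in> null T"
proof -
  let ?J = "{x \<in> carr T. hpart 0 x \<in> null T \<and> hpart 1 x \<in> null T}"
  have sub: "fin.subspace ?J"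
    using subspace_T
    by (auto simp: fin.subspace_def fin2.linear_add[OF flinear_hpart] fin2.linear_scale[OF flinear_hpart]
         fin2.linear_0[OF flinear_hpart])
  have hc: "x \<in> carr T \<Longrightarrow> hpart n x \<in> carr T" for x n by (rule vhomD(1)[OF vhom_hpart])
  have "two_sided_ideal T ?J"
    unfolding two_sided_ideal_def T_simps
  proof (intro conjI ballI sub)
    show "null T \<subseteq> ?J"
      using vspaceD(5)[OF vspace_T] vhomD(2)[OF vhom_hpart] by blast
    show "?J \<subseteq> carr T" by blast
    fix x y assume x: "x \<in> carr T" and y: "y \<in> ?J"
    note l = vhomD(2)[OF vhom_wmul2[OF hc[OF x]]] and r = vhomD(2)[OF vhom_wmul1[OF hc[OF x]]]
    show "wmul x y \<in> ?J" "wmul y x \<in> ?J"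
      using x y l r by (simp_all only: mem_Collect_eq hpart_0_wmul hpart_1_wmul wmul_carr_T
          vspace_closed(3)[OF vspace_T] simp_thms)
  qed
  moreover have "E_sum T \<subseteq> ?J"
    using tpow_le_T vspace_closed(1)[OF vspace_T]
    by (intro E_sum_subset sub) (auto simp: hpart_homogeneous)
  ultimately show ?thesis using I_subset assms by blast
qed

lemma vhom_S_wmul: "z \<in> carr T \<Longrightarrow> vhom S S (\<lambda>x. wmul x z)" "z \<in> carr T \<Longrightarrow> vhom S S (wmul z)"
  by (rule vhom_flinear[OF vspace_S]; simp add: flinear_wmul1 flinear_wmul2 wmul_carr_T I_wmul)+

lemma vhom_S_hpart: "vhom S S (hpart 1)"
  by (rule vhom_flinear[OF vspace_S])
     (use hpart_1_I null_I vhomD(1)[OF vhom_hpart] in \<open>auto simp: flinear_hpart\<close>)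

text \<open>
  The map \<open>mulpart 1\<close> descends to \<open>S \<otimes> S\<close> because \<open>p\<^sub>1\<close> kills \<open>I\<close>. This makes the chosen representative of
  \<open>\<Delta>\<^sub>S\<^sup>1\<^sup>,\<^sup>n\<^sup>-\<^sup>1 x\<close> immaterial.
\<close>
lemma vhom_S_mulpart: "vhom (tpow S 2) S (mulpart 1)"
  unfolding mulpart_def
proof (rule vhom_tpow2I[OF vspace_S vspace_S])
  fix z assume z: "z \<in> carr S"
  then have zT: "z \<in> carr T" by simp
  have "vhom S S (\<lambda>x. wmul (hpart 1 x) z)"
    by (rule vhom_comp[OF vspace_S vspace_S vhom_S_hpart vhom_S_wmul(1)[OF zT]])
  then show "vhom S S (\<lambda>x. wmul (hpart 1 ([x, z] ! 0)) ([x, z] ! 1))" by simp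
  have "vhom S S (wmul (hpart 1 z))"
    by (rule vhom_S_wmul(2)[OF vhomD(1)[OF vhom_hpart zT]])
  then show "vhom S S (\<lambda>x. wmul (hpart 1 ([z, x] ! 0)) ([z, x] ! 1))" by simp
qed simp

lemma tpow_T_S: "null (tpow T n) \<subseteq> null (tpow S n)"
proof -
  have "t \<in> trel S n" if "t \<in> trel T n" for t
  proof -
    have w: "words S n = words T n" by (simp add: words_def)
    from that show ?thesis
    proof cases
      case (add us x y ws)
      then show ?thesis using trel.add[of us x y ws S n] by (simp add: w)
    next
      case (scl us x ws a)
      then show ?thesis using trel.scl[of us x ws S n a] by (simp add: w)
    next
      case (null us x ws)
      then show ?thesis using trel.null[of us x ws S n] null_I by (auto simp: w)
    qed
  qed
  then have "trel T n \<subseteq> trel S n" by blast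
  then show ?thesis unfolding tpow_simps by (rule fin.span_mono)
qed

text \<open>
  The other bidegrees of \<open>\<Delta> x\<close> are killed by \<open>mulpart 1\<close>, and bidegree \<open>(1, n - 1)\<close> vanishes in \<open>S \<otimes> S\<close>.
\<close>
lemma mulpart_com_E:
  assumes "x \<in> E_comp S n" "n \<ge> 2"
  shows "mulpart 1 (com T x) \<in> I"
proof -
  have x: "x \<in> fspan (word ` words V n)" using assms by (simp add: E_comp_def)
  have n: "1 + (n - 1) = n" using assms(2) by simp
  obtain f0 where f0: "com_decomp T n x f0" using com_decomp_ex[OF x] by blast
  then have "com_decomp S (1 + (n - 1)) x f0"
    unfolding n using tpow_T_S[of 2] by (auto simp: com_decomp_def veq_def)
  then obtain f where f: "com_decomp S (1 + (n - 1)) x f" and eq: "com_comp S 1 (n - 1) x = f 1"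
    by (rule com_comp_decomp)
  have fs: "\<forall>i\<le>n. f i \<in> hom2 T i (n - i)" and cs: "com T x \<approx>[tpow S 2] (\<Sum>i\<le>n. f i)"
    using f unfolding n by (simp_all add: com_decomp_def)
  have "com T x \<in> carr (tpow S 2)"
    using com_carr[of x] x tpow_le_T by (auto simp: words_def)
  then have "mulpart 1 (com T x) \<approx>[S] mulpart 1 (\<Sum>i\<le>n. f i)"
    by (intro vhom_veq[OF vspace_tpow[OF vspace_S] vspace_S vhom_S_mulpart cs]
        veq_carr[OF vspace_tpow[OF vspace_S] cs])
  also have "mulpart 1 (\<Sum>i\<le>n. f i) = mulpart 1 (f 1)"
    using assms(2) by (intro mulpart_decomp[OF fs]) simp
  finally have "mulpart 1 (com T x) \<approx>[S] mulpart 1 (f 1)" .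
  moreover have "com_comp S 1 (n - 1) x \<in> null (tpow S 2)"
    using assms unfolding E_comp_def veq_0[symmetric] by auto
  then have "mulpart 1 (f 1) \<in> null S"
    unfolding eq by (rule vhomD(2)[OF vhom_S_mulpart])
  ultimately show ?thesis using veq_null[OF vspace_S] by simp
qed

end

section \<open>Braidings of Hecke type\<close>

lemma qnum_Suc: "qnum q (Suc n) = 1 + q * qnum q n"
  unfolding qnum_def sum.lessThan_Suc_shift by (simp add: sum_distrib_left)

locale hecke_tensor_algebra = tensor_algebra V c T
  for V :: "('k::field, 'v::ab_group_add) vs" and c T +
  fixes q :: 'k
  assumes hecke: "hecke_type V c q"
begin

text \<open>
  The Hecke equation says that \<open>Id + c\<close> kills \<open>c t - q t\<close>, so this element is in \<open>E\<^sub>2(T)\<close>.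
\<close>
lemma c_hecke:
  assumes "t \<in> carr (tpow V 2)"
  shows "c t \<approx>[S] fscale q t"
proof -
  let ?x = "c t - fscale q t"
  have "?x \<in> carr (tpow V 2)"
    using vhomD(1)[OF vhom_c assms] vspace_closed(6,8)[OF vspace_tpow[OF vspace_V], of _ 2] assms by auto
  moreover have "c ?x + ?x \<approx>[tpow V 2] 0" using hecke assms by (simp add: hecke_type_def)
  ultimately have "?x \<in> E_comp T 2" by (rule E_comp_2I)
  then have "?x \<in> E_sum T" by (auto simp: E_sum_def intro: fin.span_base)
  then show ?thesis using E_sum_I by (auto simp: veq_def)
qed

lemma brd_letter_hecke:
  assumes v: "v \<in> carr V" and d: "d \<in> carr T"
  shows "brd_letter v d \<approx>[S] wmul (fscale q (word [v])) (hpart 1 d)"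
proof (rule T_eq_on_words[OF vspace_S _ _ d])
  have vT: "fscale q (word [v]) \<in> carr T"
    using vspace_closed(8)[OF vspace_T word_carr_T[of "[v]"], of q] v by simp
  show "vhom T S (brd_letter v)" by (rule vhom_S[OF vhom_brd_letter[OF v]])
  show "vhom T S (\<lambda>d. wmul (fscale q (word [v])) (hpart 1 d))"
    by (intro vhom_S vhom_wmul_comp2 vhom_hpart vT)
  fix xs assume xs: "set xs \<subseteq> carr V"
  note veq_S[OF brd_letter_word[OF v xs]]
  also have "(if length xs = 1 then c (word (v # xs)) else 0) \<approx>[S] wmul (fscale q (word [v])) (hpart 1 (word xs))"
  proof (cases "length xs = 1")
    case True
    then have "word (v # xs) \<in> carr (tpow V 2)"
      using v xs by (simp add: words_def fin.span_base)
    from c_hecke[OF this] True show ?thesis by (simp add: wmul_scale1)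
  next
    case False
    then show ?thesis using veq_refl[OF vspace_S] by simp
  qed
  finally show "brd_letter v (word xs) \<approx>[S] wmul (fscale q (word [v])) (hpart 1 (word xs))" .
qed

text \<open>
  With \<open>c\<close> replaced by \<open>q\<close>, the recursion on the first letter turns into \<open>(n + 1)\<^sub>q = 1 + q (n)\<^sub>q\<close>.
\<close>
lemma mulpart_com_word:
  assumes "set xs \<subseteq> carr V"
  shows "mulpart 1 (com T (word xs)) \<approx>[S] fscale (qnum q (length xs)) (word xs)"
  using assms
proof (induction xs)
  case Nil
  have "mulpart 1 (com T (word [])) \<approx>[T] mulpart 1 (word [word [], word []])"
    using vhom_veq[OF vspace_tpow[OF vspace_T] vspace_T vhom_mulpart[of 1] com_one pair_carr] word_carr_T by auto
  then show ?case by (auto simp: qnum_def intro: veq_S)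
next
  case (Cons v xs)
  then have v: "v \<in> carr V" and wT: "word xs \<in> carr T" by (auto intro: word_carr_T)
  let ?qv = "fscale q (word [v])"
  have vT: "?qv \<in> carr T"
    using vspace_closed(8)[OF vspace_T word_carr_T[of "[v]"], of q] v by simp
  have qT: "fscale a (word xs) \<in> carr T" for a
    using vspace_closed(8)[OF vspace_T wT, of a] by simp
  have "mulpart 1 (com T (word (v # xs))) \<approx>[S]
      word (v # xs) + lin_ext (\<lambda>ys. wmul (brd_letter v (ys ! 0)) (ys ! 1)) (com T (word xs))"
    using veq_S[OF mulpart_com_letter[OF v wT]] by simp
  also have "\<dots> \<approx>[S] word (v # xs) + fscale (q * qnum q (length xs)) (word (v # xs))"
  proof (rule veq_add[OF vspace_S veq_refl[OF vspace_S]])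
    have "lin_ext (\<lambda>ys. wmul (brd_letter v (ys ! 0)) (ys ! 1)) (com T (word xs)) \<approx>[S]
        lin_ext (\<lambda>ys. wmul ?qv (wmul (hpart 1 (ys ! 0)) (ys ! 1))) (com T (word xs))"
      unfolding veq_def S_simps
    proof (rule lin_ext_cong_mod[OF subspace_I com_carr[OF wT, simplified]])
      fix ys assume "ys \<in> words T 2"
      then obtain d e where de: "ys = [d, e]" "d \<in> carr T" "e \<in> carr T" by (auto simp: words_2)
      have "wmul (brd_letter v d) e \<approx>[S] wmul (wmul ?qv (hpart 1 d)) e"
        by (rule vhom_veq[OF vspace_S vspace_S vhom_S_wmul(1) brd_letter_hecke])
           (use de v vT in \<open>auto intro!: wmul_carr_T vhomD(1)[OF vhom_hpart]\<close>)
      then show "wmul (brd_letter v (ys ! 0)) (ys ! 1) - wmul ?qv (wmul (hpart 1 (ys ! 0)) (ys ! 1)) \<in> I"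
        using de by (simp add: wmul_assoc veq_def)
    qed
    also have "lin_ext (\<lambda>ys. wmul ?qv (wmul (hpart 1 (ys ! 0)) (ys ! 1))) (com T (word xs)) =
        wmul ?qv (mulpart 1 (com T (word xs)))"
      by (simp add: mulpart_def flinear_lin_ext_lin_ext[OF flinear_wmul2])
    also have "\<dots> \<approx>[S] wmul ?qv (fscale (qnum q (length xs)) (word xs))"
      by (rule vhom_veq[OF vspace_S vspace_S vhom_S_wmul(2)[OF vT]])
         (use Cons qT in auto)
    finally show "lin_ext (\<lambda>ys. wmul (brd_letter v (ys ! 0)) (ys ! 1)) (com T (word xs)) \<approx>[S]
        fscale (q * qnum q (length xs)) (word (v # xs))"
      by (simp add: wmul_scale1 wmul_scale2 mult.commute)
  qed
  finally show ?case by (simp add: qnum_Suc fin.scale_left_distrib)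
qed

lemma mulpart_com_homogeneous:
  assumes "x \<in> fspan (word ` words V n)"
  shows "mulpart 1 (com T x) \<approx>[S] fscale (qnum q n) x"
  by (rule vhom_eq_flinear[OF vspace_S _ vspace_T _ vhom_S[OF vhom_com_mulpart] _ _ _ assms])
     (use mulpart_com_word in \<open>auto simp: words_def fin.linear_scale_self intro!: word_carr_T\<close>)

text \<open>
  As \<open>S(S)\<close> has the same representatives and structure maps as \<open>S\<close>, it is enough that \<open>E(S)\<close> consists of elements
  of \<open>I\<close>; then even the records coincide.
\<close>
lemma S_quot_S:
  assumes "regular q"
  shows "S_quot S = S"
proof -
  have "x \<in> I" if x: "x \<in> E_comp S n" "n \<ge> 2" for x n
  proof -
    have "fscale (qnum q n) x \<in> I"
      using mulpart_com_E[OF x] mulpart_com_homogeneous[of x n] x(1) veq_null[OF vspace_S]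
      by (auto simp: E_comp_def)
    then have "fscale (inverse (qnum q n)) (fscale (qnum q n) x) \<in> I"
      by (rule fin.subspace_scale[OF subspace_I])
    then show ?thesis using assms x(2) by (simp add: regular_def)
  qed
  then have "E_sum S \<subseteq> I"
    unfolding E_sum_def[of S] S_simps by (intro fin.span_minimal[OF _ subspace_I]) auto
  moreover have "two_sided_ideal S I"
    using subspace_I I_carr I_wmul by (auto simp: two_sided_ideal_def)
  ultimately have "ideal_generated S (E_sum S) \<subseteq> I" by (auto simp: ideal_generated_def)
  moreover have "I \<subseteq> ideal_generated S (E_sum S)"
    unfolding ideal_generated_def[of S] two_sided_ideal_def S_simps(3) by blast
  ultimately show ?thesis by (simp add: S_quot_def[of S] flip: S_simps(3))
qed

end

theorem theorem8p3:
  fixes V :: "('k::field, 'v::ab_group_add) vs"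
    and c :: "('v list \<Rightarrow>\<^sub>0 'k) \<Rightarrow> ('v list \<Rightarrow>\<^sub>0 'k)"
    and q :: 'k
    and T :: "('k, 'v list \<Rightarrow>\<^sub>0 'k) gbb"
  assumes "braided_vector_space V c"
    and "hecke_type V c q"
    and "regular q"
    and "tensor_bialgebra V c T"
  shows "sdeg T \<le> 1"
proof -
  interpret hecke_tensor_algebra V c T q
    using assms by unfold_locales
  have "viso S S (\<lambda>x. x)"
    using vspace_S by (auto simp: viso_def vhom_def intro: veq_refl)
  then have "viso ((S_quot ^^ 1) T) ((S_quot ^^ Suc 1) T) (\<lambda>x. x)"
    using S_quot_S[OF assms(3)] by simp
  then show ?thesis
    unfolding sdeg_def one_enat_def by (intro Inf_lower) blast
qed

end
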